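(* Let $P\subset\mathbb{R}^d$ be a convex polytope with $n$ vertices $p_1,\ldots,p_n$. Let $T$ be a triangulation of a compact PL manifold $M$ of dimension $d$ with boundary (not necessarily orientable), and let $L:V(T)\to\{1,2,\ldots,n\}$ be a labelling such that $f_{L,P}(\partial M)\subseteq\partial P$. Suppose $\deg_2(L,\partial T)\ne0$. Then for any $y\in P$ the triangulation $T$ contains a simplex that is labelled as some simplex in $\operatorname{cov}_P(y)$.
   Context: $f_{L,P}:M\to\mathbb{R}^d$ is the piecewise linear map sending each vertex $v\in V(T)$ to $p_{L(v)}$ and affine on each simplex of $T$. $\deg_2(L,\partial T)\in\{0,1\}$ is the degree modulo 2 of the continuous map $f_{L,P}|_{\partial M}:\partial M\to\partial P$ between closed $(d-1)$-manifolds (the parity of the number of times the domain wraps around the target, e.g. the parity of the number of preimages of a generic point). $\operatorname{cov}_P(y)$ is the collection of all $d$-simplices $\operatorname{conv}(p_{i_0},\ldots,p_{i_d})$, $1\le i_0<\cdots<i_d\le n$, that contain $y$; a simplex of $T$ is labelled as a simplex in $\operatorname{cov}_P(y)$ if the set of labels of its vertices is $\{i_0,\ldots,i_d\}$ for some such simplex. *)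

theory Defs
  imports "HOL-Analysis.Analysis"
begin

text \<open>
  Simplices and simplicial complexes are those of \<open>HOL-Analysis.Polytope\<close>: a complex is a
  finite set of closed geometric simplices in a Euclidean space, and it contains the empty
  simplex as a face.
\<close>

section \<open>Piecewise linear maps and PL manifolds\<close>

definition affine_map_on :: "'a::euclidean_space set \<Rightarrow> ('a \<Rightarrow> 'b::euclidean_space) \<Rightarrow> bool" where
  "affine_map_on S f \<longleftrightarrow> (\<exists>h c. linear h \<and> (\<forall>x\<in>S. f x = h x + c))"

text \<open>
  Continuity is automatic below, since the finitely many simplices are closed and cover \<open>X\<close>;
  so is the fact that the inverse of an injective PL map is PL.
\<close>

definition pl_map_on :: "'a::euclidean_space set \<Rightarrow> ('a \<Rightarrow> 'b::euclidean_space) \<Rightarrow> bool" where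
  "pl_map_on X f \<longleftrightarrow>
     (\<exists>K. simplicial_complex K \<and> \<Union>K = X \<and> (\<forall>\<sigma>\<in>K. affine_map_on \<sigma> f))"

text \<open>
  A chart of \<open>M\<close> at \<open>x\<close>: a PL homeomorphism from a compact polyhedral neighbourhood \<open>N\<close> of \<open>x\<close>
  in \<open>M\<close> onto a \<open>d\<close>-simplex. Placing this model simplex in the ambient space of \<open>M\<close>
  is no restriction, as a nonempty \<open>d\<close>-manifold forces that space to have dimension at least \<open>d\<close>.
\<close>

definition pl_chart_at ::
  "nat \<Rightarrow> 'a::euclidean_space set \<Rightarrow> 'a \<Rightarrow> 'a set \<Rightarrow> ('a \<Rightarrow> 'a) \<Rightarrow> bool" where
  "pl_chart_at d M x N \<phi> \<longleftrightarrow>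
     N \<subseteq> M \<and> (\<exists>U. open U \<and> x \<in> U \<and> U \<inter> M \<subseteq> N) \<and>
     pl_map_on N \<phi> \<and> inj_on \<phi> N \<and> int d simplex (\<phi> ` N)"

definition pl_manifold :: "nat \<Rightarrow> 'a::euclidean_space set \<Rightarrow> bool" where
  "pl_manifold d M \<longleftrightarrow> (\<forall>x\<in>M. \<exists>N \<phi>. pl_chart_at d M x N \<phi>)"

text \<open>
  By invariance of domain it does not matter which chart at \<open>x\<close> is used.
\<close>

definition pl_boundary :: "nat \<Rightarrow> 'a::euclidean_space set \<Rightarrow> 'a set" where
  "pl_boundary d M = {x \<in> M. \<exists>N \<phi>. pl_chart_at d M x N \<phi> \<and> \<phi> x \<in> rel_frontier (\<phi> ` N)}"

section \<open>Labellings\<close>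

definition simplex_vertices :: "'a::euclidean_space set \<Rightarrow> 'a set" where
  "simplex_vertices \<sigma> = {v. v extreme_point_of \<sigma>}"

definition complex_vertices :: "'a::euclidean_space set set \<Rightarrow> 'a set" where
  "complex_vertices T = (\<Union>\<sigma>\<in>T. simplex_vertices \<sigma>)"

definition is_pl_extension ::
  "'a::euclidean_space set set \<Rightarrow> ('a \<Rightarrow> 'b::euclidean_space) \<Rightarrow> ('a \<Rightarrow> 'b) \<Rightarrow> bool" where
  "is_pl_extension T g f \<longleftrightarrow>
     (\<forall>v\<in>complex_vertices T. f v = g v) \<and> (\<forall>\<sigma>\<in>T. affine_map_on \<sigma> f)"

text \<open>
  The map \<open>f\<^sub>L\<^sub>,\<^sub>P\<close>, for the vertices \<open>p 1, \<dots>, p n\<close> of \<open>P\<close>. It exists and is uniquely determined on the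
  underlying space \<open>\<Union>T\<close> (lemmas \<open>label_map\<close> and \<open>is_pl_extension_unique\<close> below); its values
  outside \<open>\<Union>T\<close> are arbitrary.
\<close>

definition label_map ::
  "'a::euclidean_space set set \<Rightarrow> (nat \<Rightarrow> 'b::euclidean_space) \<Rightarrow> ('a \<Rightarrow> nat) \<Rightarrow> 'a \<Rightarrow> 'b" where
  "label_map T p L = (SOME f. is_pl_extension T (\<lambda>v. p (L v)) f)"

lemma simplex_hull_vertices:
  assumes "n simplex \<sigma>"
  shows "finite (simplex_vertices \<sigma>)" "\<not> affine_dependent (simplex_vertices \<sigma>)"
    "\<sigma> = convex hull (simplex_vertices \<sigma>)"
proof -
  obtain C where C: "\<not> affine_dependent C" "\<sigma> = convex hull C"
    using assms by (auto simp: simplex_def)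
  have "simplex_vertices \<sigma> = C"
    using C by (auto simp: simplex_vertices_def extreme_point_of_convex_hull_affine_independent)
  with C show "finite (simplex_vertices \<sigma>)" "\<not> affine_dependent (simplex_vertices \<sigma>)"
    "\<sigma> = convex hull (simplex_vertices \<sigma>)"
    using aff_independent_finite by auto
qed

lemma affine_maps_agree_hull:
  fixes h h' :: "'a::euclidean_space \<Rightarrow> 'b::euclidean_space"
  assumes "linear h" "linear h'" "\<And>v. v \<in> C \<Longrightarrow> h v + c = h' v + c'" "x \<in> convex hull C"
  shows "h x + c = h' x + c'"
proof -
  have lin: "linear (\<lambda>y. h y - h' y)"
    using assms(1,2) by (rule linear_compose_sub)
  have "convex ((\<lambda>y. h y - h' y) -` {c' - c})"
    by (rule convex_linear_vimage[OF lin]) simp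
  moreover have "C \<subseteq> (\<lambda>y. h y - h' y) -` {c' - c}"
    using assms(3) by (auto simp: algebra_simps)
  ultimately have "x \<in> (\<lambda>y. h y - h' y) -` {c' - c}"
    using assms(4) hull_minimal[of C _ convex] by blast
  then show ?thesis by (auto simp: algebra_simps)
qed

lemma affine_extension:
  fixes g :: "'a::euclidean_space \<Rightarrow> 'b::euclidean_space"
  assumes "\<not> affine_dependent C"
  shows "\<exists>h c. linear h \<and> (\<forall>v\<in>C. h v + c = g v)"
proof (cases "C = {}")
  case True
  then show ?thesis using linear_zero by blast
next
  case False
  then obtain a where a: "a \<in> C" by blast
  define B where "B = (\<lambda>x. -a + x) ` (C - {a})"
  have "independent B"
    using assms a affine_dependent_iff_dependent2[OF a] by (simp add: B_def)
  then obtain h where h: "linear h" "\<forall>x\<in>B. h x = g (a + x) - g a"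
    using linear_independent_extend[of B "\<lambda>x. g (a + x) - g a"] by blast
  have "h v + (g a - h a) = g v" if "v \<in> C" for v
  proof (cases "v = a")
    case False
    then have "-a + v \<in> B" using that by (auto simp: B_def)
    then have "h (-a + v) = g v - g a" using h(2) by fastforce
    then show ?thesis using h(1) by (simp add: linear_diff algebra_simps)
  qed simp
  then show ?thesis using h(1) by blast
qed

lemma is_pl_extension_exists:
  fixes g :: "'a::euclidean_space \<Rightarrow> 'b::euclidean_space"
  assumes T: "simplicial_complex T"
  shows "\<exists>f. is_pl_extension T g f"
proof -
  have simp: "\<exists>n. n simplex \<sigma>" if "\<sigma> \<in> T" for \<sigma>
    using T that by (auto simp: simplicial_complex_def)
  have "\<forall>\<sigma>\<in>T. \<exists>A. (\<exists>h c. linear h \<and> A = (\<lambda>x. h x + c)) \<and> (\<forall>v\<in>simplex_vertices \<sigma>. A v = g v)"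
    using affine_extension[of _ g] simplex_hull_vertices(2) simp by metis
  then obtain A where A:
    "\<And>\<sigma>. \<sigma> \<in> T \<Longrightarrow> \<exists>h c. linear h \<and> A \<sigma> = (\<lambda>x. h x + c)"
    "\<And>\<sigma> v. \<sigma> \<in> T \<Longrightarrow> v \<in> simplex_vertices \<sigma> \<Longrightarrow> A \<sigma> v = g v"
    by metis
  have agree: "A \<sigma> x = A \<tau> x" if st: "\<sigma> \<in> T" "\<tau> \<in> T" "x \<in> \<sigma>" "x \<in> \<tau>" for \<sigma> \<tau> x
  proof -
    let ?\<rho> = "\<sigma> \<inter> \<tau>"
    have f1: "?\<rho> face_of \<sigma>" and f2: "?\<rho> face_of \<tau>"
      using T st(1,2) unfolding simplicial_complex_def by (blast, metis Int_commute)
    have "?\<rho> \<in> T" using T st(1) f1 unfolding simplicial_complex_def by blast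
    then obtain n where n: "n simplex ?\<rho>" using simp by blast
    have v: "simplex_vertices ?\<rho> \<subseteq> simplex_vertices \<sigma>" "simplex_vertices ?\<rho> \<subseteq> simplex_vertices \<tau>"
      using extreme_point_of_face[OF f1] extreme_point_of_face[OF f2] by (auto simp: simplex_vertices_def)
    obtain h c h' c' where hh: "linear h" "A \<sigma> = (\<lambda>x. h x + c)" "linear h'" "A \<tau> = (\<lambda>x. h' x + c')"
      using A(1)[OF st(1)] A(1)[OF st(2)] by blast
    have *: "h v + c = h' v + c'" if "v \<in> simplex_vertices ?\<rho>" for v
      using A(2)[OF st(1)] A(2)[OF st(2)] v that hh(2,4) by (metis subsetD)
    have "x \<in> convex hull (simplex_vertices ?\<rho>)"
      using simplex_hull_vertices(3)[OF n] st(3,4) by blast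
    then show ?thesis
      using affine_maps_agree_hull[OF hh(1,3) *] hh(2,4) by simp
  qed
  define f where "f x = A (SOME \<sigma>. \<sigma> \<in> T \<and> x \<in> \<sigma>) x" for x
  have f: "f x = A \<sigma> x" if "\<sigma> \<in> T" "x \<in> \<sigma>" for \<sigma> x
    using agree that someI[of "\<lambda>\<sigma>. \<sigma> \<in> T \<and> x \<in> \<sigma>" \<sigma>] unfolding f_def by blast
  have "\<forall>v\<in>complex_vertices T. f v = g v"
    using f A(2) by (auto simp: complex_vertices_def simplex_vertices_def extreme_point_of_def)
  moreover have "\<forall>\<sigma>\<in>T. affine_map_on \<sigma> f"
    unfolding affine_map_on_def using f A(1) by metis
  ultimately show ?thesis unfolding is_pl_extension_def by blast
qed

lemma label_map:
  assumes "simplicial_complex T"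
  shows "is_pl_extension T (\<lambda>v. p (L v)) (label_map T p L)"
  unfolding label_map_def by (rule someI_ex[OF is_pl_extension_exists[OF assms]])

lemma is_pl_extension_unique:
  assumes T: "simplicial_complex T"
    and f: "is_pl_extension T g f" and f': "is_pl_extension T g f'" and x: "x \<in> \<Union>T"
  shows "f x = f' x"
proof -
  obtain \<sigma> n where s: "\<sigma> \<in> T" "x \<in> \<sigma>" "n simplex \<sigma>"
    using x T by (auto simp: simplicial_complex_def)
  obtain h c where h: "linear h" "\<forall>x\<in>\<sigma>. f x = h x + c"
    using f s(1) unfolding is_pl_extension_def affine_map_on_def by blast
  obtain h' c' where h': "linear h'" "\<forall>x\<in>\<sigma>. f' x = h' x + c'"
    using f' s(1) unfolding is_pl_extension_def affine_map_on_def by blast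
  have "h v + c = h' v + c'" if "v \<in> simplex_vertices \<sigma>" for v
  proof -
    have "v \<in> \<sigma>" using that by (simp add: simplex_vertices_def extreme_point_of_def)
    moreover have "f v = f' v"
      using f f' s(1) that by (auto simp: is_pl_extension_def complex_vertices_def)
    ultimately show ?thesis using h(2) h'(2) by simp
  qed
  moreover have "x \<in> convex hull (simplex_vertices \<sigma>)"
    using simplex_hull_vertices(3)[OF s(3)] s(2) by simp
  ultimately have "h x + c = h' x + c'"
    using affine_maps_agree_hull[OF h(1) h'(1)] by blast
  then show ?thesis using h(2) h'(2) s(2) by simp
qed

section \<open>The degree modulo 2 on the boundary\<close>

text \<open>
  In the rest of the theory \<open>P\<close> is a full-dimensional polytope in a Euclidean space \<open>'b\<close>,
  \<open>d = DIM('b)\<close>, and \<open>T\<close> triangulates a \<open>d\<close>-manifold whose boundary is mapped into the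
  frontier of \<open>P\<close>.

  A point of the frontier is generic if it misses the images of all boundary simplices of
  dimension less than \<open>d - 1\<close>. It then also misses the image of every \<open>(d - 1)\<close>-simplex on
  which the map is not injective, since that image is covered by the images of proper faces.
  Hence it has finitely many preimages in the boundary, and the map is a local homeomorphism
  at each of them.
\<close>

definition generic_boundary_value ::
  "'b::euclidean_space set \<Rightarrow> (nat \<Rightarrow> 'b) \<Rightarrow> 'a::euclidean_space set set \<Rightarrow> ('a \<Rightarrow> nat) \<Rightarrow> 'b \<Rightarrow> bool"
where
  "generic_boundary_value P p T L z \<longleftrightarrow>
     z \<in> frontier P \<and>
     (\<forall>\<sigma>\<in>T. \<sigma> \<subseteq> pl_boundary DIM('b) (\<Union>T) \<and> aff_dim \<sigma> < int DIM('b) - 1 \<longrightarrow>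
        z \<notin> label_map T p L ` \<sigma>)"

text \<open>
  The parity of the number of preimages of a generic point. Generic points exist, and all of
  them give the same parity, so that the existential quantifier may equally well be read as
  a universal one.
\<close>

definition deg2 ::
  "'b::euclidean_space set \<Rightarrow> (nat \<Rightarrow> 'b) \<Rightarrow> 'a::euclidean_space set set \<Rightarrow> ('a \<Rightarrow> nat) \<Rightarrow> nat"
where
  "deg2 P p T L =
     (if \<exists>z. generic_boundary_value P p T L z \<and>
             odd (card {x \<in> pl_boundary DIM('b) (\<Union>T). label_map T p L x = z})
      then 1 else 0)"

section \<open>Covering simplices\<close>

text \<open>
  A \<open>d\<close>-simplex with vertices among \<open>p 1, \<dots>, p n\<close> is represented by the set of its \<open>d + 1\<close>
  indices; requiring the convex hull to be a \<open>d\<close>-simplex excludes affinely dependent choices.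
\<close>

definition cov :: "(nat \<Rightarrow> 'b::euclidean_space) \<Rightarrow> nat \<Rightarrow> 'b \<Rightarrow> nat set set" where
  "cov p n y =
     {I. I \<subseteq> {1..n} \<and> card I = DIM('b) + 1 \<and>
         int DIM('b) simplex (convex hull (p ` I)) \<and> y \<in> convex hull (p ` I)}"

end

theory Submission
  imports Defs
begin

text \<open>
  For a generic frontier point \<open>z\<close> and a generic interior point \<open>y\<close> of \<open>P\<close>, follow the ray from \<open>y\<close>
  through \<open>z\<close>. In a \<open>d\<close>-simplex of \<open>T\<close> whose image misses \<open>y\<close>, the preimage of the ray is empty or
  a segment, so the ray hits the images of an even number of facets. Summing over all \<open>d\<close>-simplices, a
  facet counts with its number of cofaces, which is odd exactly on the boundary; a boundary facet is
  mapped into the frontier of \<open>P\<close>, which the ray meets only in \<open>z\<close>. Hence if no image of a \<open>d\<close>-simplex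
  contained \<open>y\<close>, the number of preimages of \<open>z\<close> in the boundary would be even. For generic \<open>y\<close> the
  image of the \<open>d\<close>-simplex found in this way is nondegenerate, and generic points are dense in \<open>P\<close>.
\<close>

section \<open>Generic points and a parity lemma\<close>

text \<open>The order of the choices shapes the argument. \<open>z\<close> is settled first;
  \<open>y\<close> is then moved off the flats spanned by \<open>z\<close> and fewer than
  \<open>d\<close> vertices of \<open>P\<close>, because the ray can meet a flat missing
  \<open>z\<close> only if \<open>y\<close> lies in its join with \<open>z\<close>. Genericity is
  stated for flats spanned by vertices of \<open>P\<close>: there are finitely many of them, and
  they contain the images of all lower-dimensional simplices of \<open>T\<close>, degenerate or not.
  The topological obstacle is that charts know nothing about \<open>T\<close>. The link between
  cofaces and boundary has to come from invariance of domain: two \<open>d\<close>-simplices on a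
  common facet are unfolded into an open piece of a flat, whereas near a point off the boundary
  \<open>M\<close> cannot lie within a single simplex that has this point on a facet.\<close>

lemma affine_line_mem:
  fixes x w :: "'a::real_vector"
  assumes "affine B" "s \<noteq> t" "(1 - s) *\<^sub>R x + s *\<^sub>R w \<in> B" "(1 - t) *\<^sub>R x + t *\<^sub>R w \<in> B"
  shows "(1 - r) *\<^sub>R x + r *\<^sub>R w \<in> B"
proof -
  define k where "k = (r - s) / (t - s)"
  have k: "s + k * (t - s) = r"
    using assms(2) by (simp add: k_def)
  have "(1 - k) *\<^sub>R ((1 - s) *\<^sub>R x + s *\<^sub>R w) + k *\<^sub>R ((1 - t) *\<^sub>R x + t *\<^sub>R w) \<in> B"
    using assms unfolding affine_def by simp
  also have "(1 - k) *\<^sub>R ((1 - s) *\<^sub>R x + s *\<^sub>R w) + k *\<^sub>R ((1 - t) *\<^sub>R x + t *\<^sub>R w)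
      = (1 - (s + k * (t - s))) *\<^sub>R x + (s + k * (t - s)) *\<^sub>R w"
    by (simp add: algebra_simps)
  finally show ?thesis using k by simp
qed

text \<open>If no member contains \<open>C\<close>, some two points of \<open>C\<close> lie together
  in no member. Each member then meets their line in at most one point, and finitely many points
  cannot cover the segment between them.\<close>

lemma convex_subset_Union_affine:
  fixes C :: "'a::real_vector set"
  assumes "finite \<A>" "\<And>A. A \<in> \<A> \<Longrightarrow> affine A" "convex C" "C \<subseteq> \<Union>\<A>" "C \<noteq> {}"
  shows "\<exists>A\<in>\<A>. C \<subseteq> A"
  using assms
proof (induction \<A>)
  case empty
  then show ?case by auto
next
  case (insert A \<F>)
  show ?case
  proof (rule ccontr)
    assume *: "\<not> ?case"
    then obtain x where x: "x \<in> C" "x \<notin> A" by auto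
    have "\<not> C \<subseteq> \<Union>\<F>" using * insert by auto
    then obtain w where w: "w \<in> C" "w \<notin> \<Union>\<F>" by auto
    define g where "g t = (1 - t) *\<^sub>R x + t *\<^sub>R w" for t :: real
    have fin: "finite {t. g t \<in> B}" if "B \<in> insert A \<F>" for B
    proof -
      have "s = t" if "g s \<in> B" "g t \<in> B" for s t
      proof (rule ccontr)
        assume "s \<noteq> t"
        then have "g r \<in> B" for r
          using affine_line_mem[of B s t x w r] that insert.prems(1)[OF \<open>B \<in> _\<close>] by (simp add: g_def)
        from this[of 0] this[of 1] have "x \<in> B" "w \<in> B" by (auto simp: g_def)
        then show False using x w \<open>B \<in> _\<close> by auto
      qed
      then have "{t. g t \<in> B} \<subseteq> {THE t. g t \<in> B}" by (auto intro: the_equality[symmetric])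
      then show ?thesis by (rule finite_subset) simp
    qed
    have "g t \<in> C" if "t \<in> {0..1}" for t
      using convexD_alt[OF insert.prems(2) x(1) w(1)] that by (simp add: g_def)
    then have "{0..1} \<subseteq> (\<Union>B\<in>insert A \<F>. {t. g t \<in> B})"
      using insert.prems(3) by fastforce
    moreover have "finite (\<Union>B\<in>insert A \<F>. {t. g t \<in> B})"
      using fin insert.hyps(1) by blast
    ultimately have "finite {0..1::real}" using finite_subset by blast
    then show False using infinite_Icc[of "0::real" 1] by simp
  qed
qed

text \<open>General position: every generic point below comes from here. \<open>C\<close> may be a
  piece of a hyperplane, so that points can also be moved within the frontier of a convex
  set.\<close>

lemma convex_not_covered_aff_dim:
  fixes C :: "'a::euclidean_space set"
  assumes "finite \<A>" "convex C" "C \<noteq> {}" "\<And>A. A \<in> \<A> \<Longrightarrow> aff_dim A < aff_dim C"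
  obtains x where "x \<in> C" "\<And>A. A \<in> \<A> \<Longrightarrow> x \<notin> affine hull A"
proof -
  have "\<not> C \<subseteq> \<Union>((hull) affine ` \<A>)"
  proof
    assume "C \<subseteq> \<Union>((hull) affine ` \<A>)"
    from convex_subset_Union_affine[OF _ _ assms(2) this assms(3)] assms(1)
    obtain A where "A \<in> \<A>" "C \<subseteq> affine hull A" by fastforce
    then show False using assms(4) aff_dim_subset[of C "affine hull A"] by fastforce
  qed
  then show ?thesis using that by auto
qed

text \<open>The ratio test of the simplex method: starting at \<open>l\<close>, move in direction
  \<open>k\<close> until the first decreasing coordinate reaches zero.\<close>

lemma pivot:
  fixes l k :: "'j \<Rightarrow> real"
  assumes "finite J" "\<forall>j\<in>J. 0 \<le> l j" "j0 \<in> J" "k j0 < 0"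
  shows "\<exists>r j. 0 \<le> r \<and> j \<in> J \<and> k j < 0 \<and> l j + r * k j = 0 \<and> (\<forall>i\<in>J. 0 \<le> l i + r * k i)"
proof -
  define N where "N = {j \<in> J. k j < 0}"
  define f where "f j = l j / - k j" for j
  have N: "finite N" "N \<noteq> {}" using assms by (auto simp: N_def)
  obtain j where j: "j \<in> N" "f j = Min (f ` N)"
    using Min_in[of "f ` N"] N by fastforce
  have min: "f j \<le> f i" if "i \<in> N" for i using j N that by simp
  have f0: "0 \<le> f j" using j(1) assms(2) by (auto simp: f_def N_def divide_nonneg_neg)
  have "0 \<le> l i + f j * k i" if "i \<in> J" for i
  proof (cases "k i < 0")
    case True
    then have "f j \<le> l i / - k i" using min[of i] that by (simp add: N_def f_def)
    then have "f j * (- k i) \<le> l i" using True pos_le_divide_eq[of "- k i" "f j" "l i"] by simp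
    then show ?thesis by simp
  next
    case False
    then show ?thesis using assms(2) that f0 by simp
  qed
  moreover have "l j + f j * k j = 0" using j(1) by (auto simp: f_def N_def)
  ultimately show ?thesis using f0 j(1) by (intro exI[of _ "f j"] exI[of _ j]) (auto simp: N_def)
qed

text \<open>Dependence of an indexed family. A repeated value, invisible to dependence of the set of
  values, gives the relation with coefficients 1 and -1.\<close>

lemma linear_relation_exists:
  fixes w :: "'j \<Rightarrow> 'c::euclidean_space"
  assumes "finite J" "DIM('c) < card J"
  shows "\<exists>k. (\<exists>j\<in>J. k j \<noteq> 0) \<and> (\<Sum>j\<in>J. k j *\<^sub>R w j) = 0"
proof (cases "inj_on w J")
  case True
  have "dependent (w ` J)"
    using dependent_biggerset[of "w ` J"] assms card_image[OF True] by auto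
  then obtain u v where "v \<in> w ` J" "u v \<noteq> 0" "(\<Sum>v\<in>w ` J. u v *\<^sub>R v) = 0"
    using dependent_finite[of "w ` J"] assms(1) by auto
  then show ?thesis
    using True by (intro exI[of _ "u \<circ> w"]) (auto simp: sum.reindex)
next
  case False
  then obtain i j where ij: "i \<in> J" "j \<in> J" "i \<noteq> j" "w i = w j" by (auto simp: inj_on_def)
  define k where "k = (\<lambda>_. 0::real)(i := 1, j := -1)"
  have "(\<Sum>a\<in>J. k a *\<^sub>R w a) = (\<Sum>a\<in>{i, j}. k a *\<^sub>R w a)"
    using ij assms(1) by (intro sum.mono_neutral_right) (auto simp: k_def)
  also have "\<dots> = 0" using ij by (simp add: k_def)
  finally show ?thesis using ij by (intro exI[of _ k]) (auto simp: k_def)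
qed

text \<open>The solution set is a segment: its relative interior has no vanishing coordinate, its two ends have one each.\<close>

lemma even_card_vanishing_coordinates:
  fixes w :: "'j \<Rightarrow> 'c::euclidean_space" and J :: "'j set"
  defines "sol c l \<equiv> (\<forall>j\<in>J. 0 \<le> l j) \<and> (\<Sum>j\<in>J. l j *\<^sub>R w j) = c"
  assumes J: "finite J" "DIM('c) < card J"
    and bounded: "\<And>k j. sol 0 k \<Longrightarrow> j \<in> J \<Longrightarrow> k j = 0"
    and simple: "\<And>l i j. sol b l \<Longrightarrow> i \<in> J \<Longrightarrow> j \<in> J \<Longrightarrow> l i = 0 \<Longrightarrow> l j = 0 \<Longrightarrow> i = j"
  shows "even (card {j \<in> J. \<exists>l. sol b l \<and> l j = 0})"
proof (cases "\<exists>l. sol b l")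
  case False
  then have "{j \<in> J. \<exists>l. sol b l \<and> l j = 0} = {}" by auto
  then show ?thesis by (simp only: card.empty even_zero)
next
  case True
  then obtain l where l: "sol b l" ..
  have neg: "\<exists>j\<in>J. k j < 0" if "(\<Sum>j\<in>J. k j *\<^sub>R w j) = 0" "\<exists>j\<in>J. k j \<noteq> 0" for k
    using that bounded[of k] unfolding sol_def by (meson not_less)
  have move: "sol b (\<lambda>j. l j + r * k j)"
    if "sol b l" "(\<Sum>j\<in>J. k j *\<^sub>R w j) = 0" "\<forall>j\<in>J. 0 \<le> l j + r * k j" for l k r
  proof -
    have "(\<Sum>j\<in>J. (l j + r * k j) *\<^sub>R w j) = (\<Sum>j\<in>J. l j *\<^sub>R w j) + r *\<^sub>R (\<Sum>j\<in>J. k j *\<^sub>R w j)"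
      by (simp add: algebra_simps sum.distrib scaleR_right.sum)
    then show ?thesis using that by (simp add: sol_def)
  qed
  \<comment> \<open>Moving from \<open>l'\<close> along a nonzero \<open>k\<close> of this kind
    keeps coordinate \<open>v\<close> at zero until a second coordinate vanishes, which
    \<open>simple\<close> forbids.\<close>
  have no_kernel: "\<forall>j\<in>J. k j = 0"
    if l': "sol b l'" "v \<in> J" "l' v = 0" and k: "(\<Sum>j\<in>J. k j *\<^sub>R w j) = 0" "k v = 0" for l' k v
  proof (rule ccontr)
    assume "\<not> ?thesis"
    then obtain j0 where j0: "j0 \<in> J" "k j0 < 0" using neg k(1) by auto
    have nn: "\<forall>j\<in>J. 0 \<le> l' j" using l'(1) by (simp add: sol_def)
    obtain r j where rj: "0 \<le> r" "j \<in> J" "k j < 0" "l' j + r * k j = 0" "\<forall>i\<in>J. 0 \<le> l' i + r * k i"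
      using pivot[where k = k and l = l', OF J(1) nn j0] by (elim exE conjE) (rule that)
    have "j = v"
      using simple[OF move[OF l'(1) k(1) rj(5)] rj(2) l'(2)] rj(4) l'(3) k(2) by simp
    then show False using rj(3) k(2) by simp
  qed
  \<comment> \<open>\<open>m\<close> is the direction of the segment of solutions; the ratio test
    along \<open>m\<close> and along its negative yields the two ends.\<close>
  obtain m where m: "\<exists>j\<in>J. m j \<noteq> 0" "(\<Sum>j\<in>J. m j *\<^sub>R w j) = 0"
    using linear_relation_exists[OF J] by blast
  have m': "(\<Sum>j\<in>J. - m j *\<^sub>R w j) = 0" using m(2) by (simp add: sum_negf)
  obtain a0 where a0: "a0 \<in> J" "m a0 < 0" using neg m by blast
  obtain b0 where b0: "b0 \<in> J" "- m b0 < 0" using neg[of "\<lambda>j. - m j"] m m' by auto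
  have lnn: "\<forall>j\<in>J. 0 \<le> l j" using l by (simp add: sol_def)
  obtain r0 a where a: "0 \<le> r0" "a \<in> J" "m a < 0" "l a + r0 * m a = 0"
      "\<forall>i\<in>J. 0 \<le> l i + r0 * m i"
    using pivot[where k = m and l = l, OF J(1) lnn a0] by (elim exE conjE) (rule that)
  obtain r1 c where c: "0 \<le> r1" "c \<in> J" "- m c < 0" "l c + r1 * - m c = 0"
      "\<forall>i\<in>J. 0 \<le> l i + r1 * - m i"
    using pivot[where k = "\<lambda>j. - m j" and l = l, OF J(1) lnn b0] by (elim exE conjE) (rule that)
  have sa: "sol b (\<lambda>j. l j + r0 * m j)" using move[OF l m(2) a(5)] .
  have sc: "sol b (\<lambda>j. l j + r1 * - m j)" using move[OF l m' c(5)] .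
  have "v = a \<or> v = c" if v: "v \<in> J" "sol b l'" "l' v = 0" for v l'
  proof -
    have mv: "m v \<noteq> 0" using no_kernel[OF v(2,1,3) m(2)] m(1) by auto
    \<comment> \<open>With this \<open>s\<close> the relation \<open>k\<close> vanishes at
      \<open>v\<close>, hence everywhere, so \<open>l'\<close> lies on the line through
      \<open>l\<close> in direction \<open>m\<close>. The sign of \<open>m v\<close> tells at which
      end.\<close>
    define s where "s = l v / m v"
    define k where "k j = l' j - l j + s * m j" for j
    have "(\<Sum>j\<in>J. k j *\<^sub>R w j) = (\<Sum>j\<in>J. l' j *\<^sub>R w j) - (\<Sum>j\<in>J. l j *\<^sub>R w j) + s *\<^sub>R (\<Sum>j\<in>J. m j *\<^sub>R w j)"
      by (simp add: k_def algebra_simps sum.distrib sum_subtractf scaleR_right.sum)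
    then have "(\<Sum>j\<in>J. k j *\<^sub>R w j) = 0" using m(2) l v(2) by (simp add: sol_def)
    moreover have "k v = 0" using mv v(3) by (simp add: k_def s_def)
    ultimately have "\<forall>j\<in>J. k j = 0" using no_kernel[OF v(2,1,3)] by blast
    then have l': "l' j = l j - s * m j" if "j \<in> J" for j using that by (auto simp: k_def)
    have nn: "0 \<le> l' j" if "j \<in> J" for j using v(2) that by (simp add: sol_def)
    have "0 \<le> (r0 + s) * - m a" using nn[OF a(2)] l'[OF a(2)] a(4) by (simp add: algebra_simps)
    then have 1: "0 \<le> r0 + s" using a(3) by (simp add: zero_le_mult_iff mult_le_0_iff)
    have "0 \<le> (r1 - s) * m c" using nn[OF c(2)] l'[OF c(2)] c(4) by (simp add: algebra_simps)
    then have 2: "0 \<le> r1 - s" using c(3) by (simp add: zero_le_mult_iff mult_le_0_iff)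
    show ?thesis
    proof (cases "m v < 0")
      case True
      have "0 \<le> (r0 + s) * m v" using bspec[OF a(5) v(1)] l'[OF v(1)] v(3) by (simp add: algebra_simps)
      then have "r0 + s = 0" using 1 True by (simp add: zero_le_mult_iff mult_le_0_iff)
      then have "l' a = 0" using l'[OF a(2)] a(4) by (simp add: eq_neg_iff_add_eq_0[symmetric])
      then show ?thesis using simple[OF v(2,1) a(2) v(3)] by simp
    next
      case False
      have "0 \<le> (s - r1) * m v" using bspec[OF c(5) v(1)] l'[OF v(1)] v(3) by (simp add: algebra_simps)
      then have "r1 - s = 0" using 2 False mv by (simp add: zero_le_mult_iff mult_le_0_iff)
      then have "l' c = 0" using l'[OF c(2)] c(4) by simp
      then show ?thesis using simple[OF v(2,1) c(2) v(3)] by simp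
    qed
  qed
  then have "{j \<in> J. \<exists>l. sol b l \<and> l j = 0} = {a, c}"
    using a(2,4) c(2,4) sa sc by auto
  moreover have "a \<noteq> c" using a(3) c(3) by auto
  ultimately show ?thesis by simp
qed

section \<open>Charts and the boundary of a PL manifold\<close>

lemma affine_map_on_continuous:
  assumes "affine_map_on S f"
  shows "continuous_on S f"
proof -
  obtain h c where h: "linear h" "\<forall>x\<in>S. f x = h x + c"
    using assms by (auto simp: affine_map_on_def)
  have "continuous_on S (\<lambda>x. h x + c)"
    using h(1) by (intro continuous_intros linear_continuous_on) (simp add: linear_conv_bounded_linear)
  then show ?thesis using h(2) by (simp cong: continuous_on_cong)
qed

lemma pl_map_on_continuous:
  assumes "pl_map_on X f"
  shows "compact X" "continuous_on X f"
proof -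
  obtain K where K: "simplicial_complex K" "\<Union>K = X" "\<forall>\<sigma>\<in>K. affine_map_on \<sigma> f"
    using assms by (auto simp: pl_map_on_def)
  have fin: "finite K" and cpt: "\<And>\<sigma>. \<sigma> \<in> K \<Longrightarrow> compact \<sigma>"
    using K(1) compact_simplex unfolding simplicial_complex_def by blast+
  show "compact X" using fin cpt K(2) by auto
  have "continuous_on \<sigma> f" if "\<sigma> \<in> K" for \<sigma>
    using K(3) that affine_map_on_continuous by auto
  then have "continuous_on (\<Union>\<sigma>\<in>K. \<sigma>) f"
    using fin cpt by (intro continuous_on_closed_Union) (auto simp: compact_imp_closed)
  then show "continuous_on X f" using K(2) by simp
qed

lemma pl_chart_at_facts:
  assumes "pl_chart_at d M x N \<phi>"
  shows "compact N" "continuous_on N \<phi>" "inj_on \<phi> N" "N \<subseteq> M" "aff_dim (\<phi> ` N) = int d"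
    "convex (\<phi> ` N)" "closed (\<phi> ` N)" "x \<in> M \<Longrightarrow> x \<in> N"
proof -
  show "compact N" "continuous_on N \<phi>" "inj_on \<phi> N" "N \<subseteq> M"
    using assms pl_map_on_continuous by (auto simp: pl_chart_at_def)
  show "aff_dim (\<phi> ` N) = int d" "convex (\<phi> ` N)" "closed (\<phi> ` N)" "x \<in> M \<Longrightarrow> x \<in> N"
    using assms aff_dim_simplex convex_simplex closed_simplex by (auto simp: pl_chart_at_def)
qed

lemma pl_chart_at_inverse:
  assumes "pl_chart_at d M x N \<phi>"
  obtains g where "homeomorphism N (\<phi> ` N) \<phi> g"
  using homeomorphism_compact[of N \<phi>] pl_chart_at_facts[OF assms] by auto

text \<open>Following \<open>h\<close> by the chart gives an injective continuous map between
  \<open>d\<close>-flats, which is open. It is applied to three parametrizations \<open>h\<close> of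
  \<open>M\<close> near \<open>x\<close>: the inverse of another chart, the inclusion of the
  interior of a \<open>d\<close>-simplex, and the unfolding of two adjacent simplices.\<close>

lemma pl_chart_at_invariance_of_domain:
  assumes c: "pl_chart_at d M x N \<phi>"
    and W: "openin (top_of_set A) W" "affine A" "aff_dim A = int d"
    and h: "continuous_on W h" "inj_on h W" "h ` W \<subseteq> M" "w \<in> W" "h w = x"
  shows "\<phi> x \<in> rel_interior (\<phi> ` N)"
    and "\<exists>U. open U \<and> x \<in> U \<and> U \<inter> M \<subseteq> h ` W"
proof -
  note cf = pl_chart_at_facts[OF c]
  obtain U where U: "open U" "x \<in> U" "U \<inter> M \<subseteq> N"
    using c by (auto simp: pl_chart_at_def)
  define W' where "W' = W \<inter> h -` U"
  define G where "G = (\<phi> \<circ> h) ` W'"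
  have hW': "h ` W' \<subseteq> N" using h(3) U(3) by (auto simp: W'_def)
  have "openin (top_of_set W) W'"
    unfolding W'_def using h(1) U(1) continuous_openin_preimage_gen by blast
  then have "openin (top_of_set A) W'" using W(1) openin_trans by blast
  then have G: "openin (top_of_set (affine hull (\<phi> ` N))) G"
    unfolding G_def
  proof (rule invariance_of_domain_affine_sets)
    show "continuous_on W' (\<phi> \<circ> h)"
      using h(1) cf(2) hW' by (intro continuous_on_compose) (auto simp: W'_def elim: continuous_on_subset)
    show "\<phi> \<circ> h \<in> W' \<rightarrow> affine hull \<phi> ` N" using hW' by (auto intro!: hull_inc)
    show "inj_on (\<phi> \<circ> h) W'"
      using h(2) cf(3) hW' by (intro comp_inj_on) (auto simp: W'_def elim: inj_on_subset)
  qed (use W cf in \<open>auto simp: aff_dim_affine_hull\<close>)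
  have GN: "G \<subseteq> \<phi> ` N" using hW' by (auto simp: G_def)
  have "\<phi> x \<in> G" using h(4,5) U(2) by (auto simp: G_def W'_def)
  then show "\<phi> x \<in> rel_interior (\<phi> ` N)" using rel_interior_maximal[OF GN G] by blast
  obtain O' where O': "open O'" "G = affine hull (\<phi> ` N) \<inter> O'" using G by (auto simp: openin_open)
  have "openin (top_of_set N) (N \<inter> \<phi> -` O')" using cf(2) O'(1) continuous_openin_preimage_gen by blast
  then obtain V where V: "open V" "N \<inter> \<phi> -` O' = N \<inter> V" by (auto simp: openin_open)
  have xN: "x \<in> N" using h(3,4,5) U by auto
  \<comment> \<open>A point of \<open>M\<close> in both open sets lies in the chart domain and has
    its chart value in \<open>G\<close>; injectivity of the chart then puts it in the image of
    \<open>h\<close>.\<close>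
  have "U \<inter> V \<inter> M \<subseteq> h ` W"
  proof
    fix y assume y: "y \<in> U \<inter> V \<inter> M"
    then have yN: "y \<in> N" using U(3) by auto
    then have "\<phi> y \<in> G" using y V(2) O'(2) by (auto intro!: hull_inc)
    then obtain w' where w': "w' \<in> W'" "\<phi> y = \<phi> (h w')" by (auto simp: G_def)
    then have "y = h w'" using yN hW' cf(3) by (auto dest: inj_onD)
    then show "y \<in> h ` W" using w'(1) by (auto simp: W'_def)
  qed
  moreover have "x \<in> V" using xN V(2) \<open>\<phi> x \<in> G\<close> O'(2) by auto
  ultimately show "\<exists>U. open U \<and> x \<in> U \<and> U \<inter> M \<subseteq> h ` W"
    using U V(1) by (intro exI[of _ "U \<inter> V"]) auto
qed

lemma pl_chart_at_interior_param:
  assumes c: "pl_chart_at d M x N \<phi>" and x: "x \<in> M" "\<phi> x \<in> rel_interior (\<phi> ` N)"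
  obtains W h where "openin (top_of_set (affine hull (\<phi> ` N))) W" "continuous_on W h" "inj_on h W"
    "h ` W \<subseteq> N" "\<phi> x \<in> W" "h (\<phi> x) = x"
proof -
  note cf = pl_chart_at_facts[OF c]
  obtain g where g: "homeomorphism N (\<phi> ` N) \<phi> g" using pl_chart_at_inverse[OF c] .
  let ?W = "rel_interior (\<phi> ` N)"
  have sub: "?W \<subseteq> \<phi> ` N" by (rule rel_interior_subset)
  have "continuous_on ?W g" using homeomorphism_cont2[OF g] sub continuous_on_subset by blast
  moreover have "inj_on g ?W"
    by (rule inj_on_inverseI[of _ \<phi>]) (use homeomorphism_apply2[OF g] sub in blast)
  moreover have "g ` ?W \<subseteq> N" using homeomorphism_image2[OF g] sub by blast
  moreover have "g (\<phi> x) = x" using homeomorphism_apply1[OF g cf(8)[OF x(1)]] .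
  ultimately   show ?thesis using that[of ?W g] x(2) openin_rel_interior by blast
qed

text \<open>A chart with \<open>x\<close> in the relative interior has an inverse that parametrizes
  \<open>M\<close> near \<open>x\<close> by an open piece of a \<open>d\<close>-flat, and this
  forces \<open>x\<close> into the relative interior of every other chart.\<close>

lemma pl_boundary_chart_iff:
  assumes c: "pl_chart_at d M x N \<phi>" and x: "x \<in> M"
  shows "x \<in> pl_boundary d M \<longleftrightarrow> \<phi> x \<in> rel_frontier (\<phi> ` N)"
proof
  assume "\<phi> x \<in> rel_frontier (\<phi> ` N)"
  then show "x \<in> pl_boundary d M" using c x by (auto simp: pl_boundary_def)
next
  assume "x \<in> pl_boundary d M"
  then obtain N' \<phi>' where c': "pl_chart_at d M x N' \<phi>'" "\<phi>' x \<in> rel_frontier (\<phi>' ` N')"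
    by (auto simp: pl_boundary_def)
  note cf = pl_chart_at_facts[OF c]
  show "\<phi> x \<in> rel_frontier (\<phi> ` N)"
  proof (rule ccontr)
    assume "\<not> ?thesis"
    then have int: "\<phi> x \<in> rel_interior (\<phi> ` N)"
      using cf(7) cf(8)[OF x] by (auto simp: rel_frontier_def)
    obtain W h where W: "openin (top_of_set (affine hull (\<phi> ` N))) W" "continuous_on W h" "inj_on h W"
        "h ` W \<subseteq> N" "\<phi> x \<in> W" "h (\<phi> x) = x"
      using pl_chart_at_interior_param[OF c x int] .
    have "\<phi>' x \<in> rel_interior (\<phi>' ` N')"
      by (rule pl_chart_at_invariance_of_domain(1)[OF c'(1) W(1) _ _ W(2,3) _ W(5,6)])
        (use W(4) cf in \<open>auto simp: aff_dim_affine_hull\<close>)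
    then show False using c'(2) by (auto simp: rel_frontier_def)
  qed
qed

text \<open>The point enters a chart only through the neighbourhood condition, so one chart decides
  boundary membership for all points near \<open>x\<close>.\<close>

lemma pl_chart_at_near:
  assumes "pl_chart_at d M x N \<phi>"
  obtains U where "open U" "x \<in> U" "U \<inter> M \<subseteq> N" "\<And>x'. x' \<in> U \<Longrightarrow> pl_chart_at d M x' N \<phi>"
  using assms that unfolding pl_chart_at_def by blast

lemma closed_pl_boundary:
  assumes M: "pl_manifold d M" and x: "x \<in> M" "x \<in> closure (pl_boundary d M)"
  shows "x \<in> pl_boundary d M"
proof -
  obtain N \<phi> where c: "pl_chart_at d M x N \<phi>" using M x(1) by (auto simp: pl_manifold_def)
  note cf = pl_chart_at_facts[OF c]
  obtain U where U: "open U" "x \<in> U" "U \<inter> M \<subseteq> N" "\<And>x'. x' \<in> U \<Longrightarrow> pl_chart_at d M x' N \<phi>"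
    using pl_chart_at_near[OF c] by blast
  obtain X where X: "\<And>n. X n \<in> pl_boundary d M" "X \<longlonglongrightarrow> x"
    using x(2) by (auto simp: closure_sequential)
  have ev: "\<forall>\<^sub>F n in sequentially. X n \<in> U" using X(2) U(1,2) by (rule topological_tendstoD)
  have XM: "X n \<in> M" for n using X(1) by (auto simp: pl_boundary_def)
  have "\<forall>\<^sub>F n in sequentially. \<phi> (X n) \<in> rel_frontier (\<phi> ` N)"
    using ev by eventually_elim (use pl_boundary_chart_iff U(4) XM X(1) in blast)
  moreover have "((\<lambda>n. \<phi> (X n)) \<longlongrightarrow> \<phi> x) sequentially"
    using cf(2) X(2) cf(8)[OF x(1)]
    by (rule continuous_on_tendsto_compose) (use ev U(3) XM in \<open>auto elim!: eventually_mono\<close>)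
  ultimately have "\<phi> x \<in> rel_frontier (\<phi> ` N)"
    using closed_rel_frontier by (intro Lim_in_closed_set) auto
  then show ?thesis using c x(1) by (auto simp: pl_boundary_def)
qed

lemma affine_map_on_aff_dim_le:
  assumes "affine_map_on S f" "X \<subseteq> S"
  shows "aff_dim (f ` X) \<le> aff_dim X"
proof -
  obtain h c where h: "linear h" "\<forall>x\<in>S. f x = h x + c"
    using assms(1) by (auto simp: affine_map_on_def)
  have "f ` X = (+) c ` (h ` X)" using h(2) assms(2) by (force simp: image_iff add.commute)
  then show ?thesis using aff_dim_linear_image_le[OF h(1)] by (simp add: aff_dim_translation_eq)
qed

text \<open>Piecewise linearity of the chart enters here: on each piece where the chart is affine,
  the image of a low-dimensional set is again low-dimensional, so finitely many flats have to be
  avoided.\<close>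

lemma pl_chart_at_avoid_low_dim:
  assumes c: "pl_chart_at d M x N \<phi>"
    and C: "convex C" "C \<noteq> {}" "C \<subseteq> \<phi> ` N"
    and \<R>: "finite \<R>" "\<And>\<rho>. \<rho> \<in> \<R> \<Longrightarrow> aff_dim \<rho> < aff_dim C"
  obtains y where "y \<in> N" "\<phi> y \<in> C" "y \<notin> \<Union>\<R>"
proof -
  obtain K where K: "simplicial_complex K" "\<Union>K = N" "\<forall>\<sigma>\<in>K. affine_map_on \<sigma> \<phi>"
    using c by (auto simp: pl_chart_at_def pl_map_on_def)
  define \<A> where "\<A> = (\<lambda>(\<kappa>, \<rho>). \<phi> ` (\<kappa> \<inter> \<rho>)) ` (K \<times> \<R>)"
  have "finite K" using K(1) by (simp add: simplicial_complex_def)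
  then have fin: "finite \<A>" using \<R>(1) by (simp add: \<A>_def)
  have "aff_dim A < aff_dim C" if "A \<in> \<A>" for A
  proof -
    obtain \<kappa> \<rho> where k: "\<kappa> \<in> K" "\<rho> \<in> \<R>" "A = \<phi> ` (\<kappa> \<inter> \<rho>)" using \<open>A \<in> \<A>\<close> by (auto simp: \<A>_def)
    have "aff_dim A \<le> aff_dim (\<kappa> \<inter> \<rho>)" using K(3) k affine_map_on_aff_dim_le by blast
    also have "\<dots> \<le> aff_dim \<rho>" by (simp add: aff_dim_subset)
    finally show ?thesis using \<R>(2)[OF k(2)] by simp
  qed
  then obtain z where z: "z \<in> C" "\<And>A. A \<in> \<A> \<Longrightarrow> z \<notin> affine hull A"
    using convex_not_covered_aff_dim[OF fin C(1,2)] by blast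
  then obtain y where y: "y \<in> N" "z = \<phi> y" using C(3) by auto
  have "y \<notin> \<rho>" if "\<rho> \<in> \<R>" for \<rho>
  proof
    assume "y \<in> \<rho>"
    obtain \<kappa> where "\<kappa> \<in> K" "y \<in> \<kappa>" using y(1) K(2) by auto
    then have "z \<in> \<phi> ` (\<kappa> \<inter> \<rho>)" "\<phi> ` (\<kappa> \<inter> \<rho>) \<in> \<A>" using \<open>y \<in> \<rho>\<close> that y(2) by (auto simp: \<A>_def)
    then show False using z(2) hull_inc by metis
  qed
  then show ?thesis using that y z(1) by auto
qed

lemma pl_chart_at_small_ball:
  assumes c: "pl_chart_at d M x N \<phi>" and x: "x \<in> M" and V: "open V" "x \<in> V"
  obtains e where "0 < e" "\<forall>y\<in>N. \<phi> y \<in> ball (\<phi> x) e \<longrightarrow> y \<in> V"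
proof -
  obtain g where g: "homeomorphism N (\<phi> ` N) \<phi> g" using pl_chart_at_inverse[OF c] .
  have "openin (top_of_set N) (N \<inter> V)" using V(1) by auto
  then have "openin (top_of_set (\<phi> ` N)) (\<phi> ` (N \<inter> V))" using homeomorphism_imp_open_map[OF g] by blast
  then obtain O' where O': "open O'" "\<phi> ` (N \<inter> V) = \<phi> ` N \<inter> O'" by (auto simp: openin_open)
  have "x \<in> N" using pl_chart_at_facts(8)[OF c x] .
  then have "\<phi> x \<in> O'" using V(2) O'(2) by blast
  then obtain e where e: "0 < e" "ball (\<phi> x) e \<subseteq> O'" using O'(1) openE by blast
  have "y \<in> V" if "y \<in> N" "\<phi> y \<in> ball (\<phi> x) e" for y
  proof -
    have "\<phi> y \<in> \<phi> ` (N \<inter> V)" using that e(2) O'(2) by blast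
    then show ?thesis using pl_chart_at_facts(3)[OF c] that(1) by (auto dest: inj_onD)
  qed
  then show ?thesis using that e(1) by blast
qed

section \<open>Dimension and purity of a triangulation of a PL manifold\<close>

lemma simplex_aff_dim_le_manifold:
  assumes M: "pl_manifold d M" and s: "n simplex \<sigma>" "\<sigma> \<subseteq> M"
  shows "aff_dim \<sigma> \<le> int d"
proof (cases "\<sigma> = {}")
  case False
  then obtain x where x: "x \<in> rel_interior \<sigma>"
    using s(1) convex_simplex rel_interior_eq_empty by blast
  then have xM: "x \<in> M" using s(2) rel_interior_subset by blast
  obtain N \<phi> where c: "pl_chart_at d M x N \<phi>" using M xM by (auto simp: pl_manifold_def)
  note cf = pl_chart_at_facts[OF c]
  obtain U where U: "open U" "x \<in> U" "U \<inter> M \<subseteq> N" using c by (auto simp: pl_chart_at_def)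
  have UN: "rel_interior \<sigma> \<inter> U \<subseteq> N" using U(3) s(2) rel_interior_subset by blast
  have "aff_dim (affine hull \<sigma>) \<le> aff_dim (affine hull (\<phi> ` N))"
  proof (rule invariance_of_dimension_affine_sets)
    have "openin (top_of_set (rel_interior \<sigma>)) (rel_interior \<sigma> \<inter> U)" using U(1) by auto
    then show "openin (top_of_set (affine hull \<sigma>)) (rel_interior \<sigma> \<inter> U)"
      using openin_rel_interior openin_trans by blast
    show "continuous_on (rel_interior \<sigma> \<inter> U) \<phi>" using cf(2) UN continuous_on_subset by blast
    show "inj_on \<phi> (rel_interior \<sigma> \<inter> U)" using cf(3) UN inj_on_subset by blast
    show "\<phi> \<in> rel_interior \<sigma> \<inter> U \<rightarrow> affine hull \<phi> ` N" using UN by (auto intro!: hull_inc)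
  qed (use x U(2) in auto)
  then show ?thesis using cf(5) by (simp add: aff_dim_affine_hull)
qed simp

text \<open>A point missing all \<open>d\<close>-simplices has a neighbourhood \<open>V\<close>
  missing them. Its chart image is \<open>d\<close>-dimensional, so it contains a point off all
  simplices of smaller dimension as well; larger dimensions do not occur.\<close>

lemma manifold_triangulation_pure:
  assumes M: "pl_manifold d M" and T: "simplicial_complex T" "\<Union>T = M" and x: "x \<in> M"
  shows "\<exists>\<sigma>\<in>T. aff_dim \<sigma> = int d \<and> x \<in> \<sigma>"
proof (rule ccontr)
  assume no: "\<not> ?thesis"
  have fin: "finite T" and cl: "\<And>\<sigma>. \<sigma> \<in> T \<Longrightarrow> closed \<sigma>"
    using T(1) closed_simplex unfolding simplicial_complex_def by blast+
  define V where "V = - \<Union>{\<sigma> \<in> T. aff_dim \<sigma> = int d}"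
  have V: "open V" "x \<in> V" using fin cl no by (auto simp: V_def intro!: closed_Union)
  obtain N \<phi> where c: "pl_chart_at d M x N \<phi>" using M x by (auto simp: pl_manifold_def)
  note cf = pl_chart_at_facts[OF c]
  obtain e where e: "0 < e" "\<forall>y\<in>N. \<phi> y \<in> ball (\<phi> x) e \<longrightarrow> y \<in> V"
    using pl_chart_at_small_ball[OF c x V] .
  let ?C = "\<phi> ` N \<inter> ball (\<phi> x) e"
  have ne: "?C \<noteq> {}" using cf(8)[OF x] e(1) by fastforce
  have dim: "aff_dim ?C = int d" using aff_dim_convex_Int_open[OF cf(6) _ ne] cf(5) by simp
  obtain y where y: "y \<in> N" "\<phi> y \<in> ?C" "y \<notin> \<Union>{\<sigma> \<in> T. aff_dim \<sigma> < int d}"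
    by (rule pl_chart_at_avoid_low_dim[OF c, of ?C "{\<sigma> \<in> T. aff_dim \<sigma> < int d}"])
      (use cf(6) ne dim fin in \<open>auto intro: convex_Int\<close>)
  have "y \<in> M" using y(1) cf(4) by blast
  then obtain \<sigma> where s: "\<sigma> \<in> T" "y \<in> \<sigma>" using T(2) by blast
  obtain n where "n simplex \<sigma>" using T(1) s(1) unfolding simplicial_complex_def by blast
  then have "aff_dim \<sigma> \<le> int d"
    using simplex_aff_dim_le_manifold[OF M, of n \<sigma>] T(2) s(1) by blast
  moreover have "y \<in> V" using e(2) y(1,2) by blast
  ultimately show False using s y(3) by (force simp: V_def)
qed

lemma rel_interior_simplex_not_pl_boundary:
  assumes s: "\<sigma> \<subseteq> M" "aff_dim \<sigma> = int d" "x \<in> rel_interior \<sigma>"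
  shows "x \<notin> pl_boundary d M"
proof
  assume "x \<in> pl_boundary d M"
  then obtain N \<phi> where c: "pl_chart_at d M x N \<phi>" "\<phi> x \<in> rel_frontier (\<phi> ` N)"
    by (auto simp: pl_boundary_def)
  have "\<phi> x \<in> rel_interior (\<phi> ` N)"
    by (rule pl_chart_at_invariance_of_domain(1)[OF c(1), of "affine hull \<sigma>" "rel_interior \<sigma>" id x])
      (use s rel_interior_subset in \<open>auto simp: aff_dim_affine_hull openin_rel_interior\<close>)
  then show False using c(2) by (auto simp: rel_frontier_def)
qed

section \<open>Two simplices with a common facet\<close>

lemma affine_map_on_sum:
  assumes f: "affine_map_on S f" and "finite V" "V \<subseteq> S" "(\<Sum>v\<in>V. u v *\<^sub>R v) \<in> S" "sum u V = 1"
  shows "f (\<Sum>v\<in>V. u v *\<^sub>R v) = (\<Sum>v\<in>V. u v *\<^sub>R f v)"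
proof -
  obtain h c where h: "linear h" "\<forall>x\<in>S. f x = h x + c"
    using f by (auto simp: affine_map_on_def)
  have "(\<Sum>v\<in>V. u v *\<^sub>R f v) = (\<Sum>v\<in>V. u v *\<^sub>R (h v + c))"
    using h(2) assms(3) by (intro sum.cong) auto
  also have "\<dots> = h (\<Sum>v\<in>V. u v *\<^sub>R v) + sum u V *\<^sub>R c"
    using h(1) by (simp add: scaleR_right_distrib sum.distrib linear_sum linear_scale scaleR_sum_left)
  finally show ?thesis using h(2) assms(4,5) by simp
qed

lemma affine_map_hull_mem:
  assumes f: "affine_map_on UNIV f" and B: "affine B" and V: "\<And>v. v \<in> V \<Longrightarrow> f v \<in> B"
    and x: "x \<in> affine hull V"
  shows "f x \<in> B"
proof -
  obtain h c where h: "linear h" "\<And>x. f x = h x + c"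
    using f by (auto simp: affine_map_on_def)
  have "affine (f -` B)"
    unfolding affine_def
  proof (intro ballI allI impI)
    fix x y and u v :: real
    assume *: "x \<in> f -` B" "y \<in> f -` B" "u + v = 1"
    have "f (u *\<^sub>R x + v *\<^sub>R y) = u *\<^sub>R h x + v *\<^sub>R h y + (u + v) *\<^sub>R c"
      using * h by (simp add: linear_add linear_scale)
    also have "\<dots> = u *\<^sub>R f x + v *\<^sub>R f y" using h(2) by (simp add: algebra_simps)
    finally show "u *\<^sub>R x + v *\<^sub>R y \<in> f -` B" using * B by (simp add: affine_def)
  qed
  moreover have "V \<subseteq> f -` B" using V by auto
  ultimately show ?thesis using x hull_minimal[of V "f -` B" affine] by auto
qed

lemma barycentric_coordinate_exists:
  fixes a :: "'a::euclidean_space"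
  assumes "\<not> affine_dependent V"
  shows "\<exists>\<beta>::'a \<Rightarrow> real. affine_map_on UNIV \<beta> \<and> (\<forall>v\<in>V. \<beta> v = (if v = a then 1 else 0))"
proof -
  obtain h :: "'a \<Rightarrow> real" and c where hc: "linear h" "\<forall>v\<in>V. h v + c = (if v = a then 1 else 0)"
    using affine_extension[OF assms, of "\<lambda>v. if v = a then 1 else 0 :: real"] by blast
  then show ?thesis
    by (intro exI[of _ "\<lambda>x. h x + c"]) (auto simp: affine_map_on_def)
qed

lemma facet_coordinate_exists:
  fixes a :: "'a::euclidean_space"
  assumes "\<not> affine_dependent (insert a C)" "a \<notin> C"
  shows "\<exists>\<alpha>::'a \<Rightarrow> real. affine_map_on UNIV \<alpha> \<and> \<alpha> a = 1 \<and> (\<forall>v\<in>C. \<alpha> v = 0)"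
proof -
  obtain \<alpha> :: "'a \<Rightarrow> real" where "affine_map_on UNIV \<alpha>" "\<forall>v\<in>insert a C. \<alpha> v = (if v = a then 1 else 0)"
    using barycentric_coordinate_exists[OF assms(1), of a] by blast
  then show ?thesis using assms(2) by (intro exI[of _ \<alpha>]) auto
qed

text \<open>Near a relative interior point of the facet the barycentric coordinates of
  \<open>C\<close> stay positive, so membership in the simplex is decided by the sign of the
  coordinate of the apex, which is \<open>\<alpha>\<close>.\<close>

lemma simplex_near_facet_point:
  fixes C :: "'a::euclidean_space set"
  assumes V: "\<not> affine_dependent (insert a C)" "a \<notin> C" and x: "x \<in> rel_interior (convex hull C)"
    and \<alpha>: "affine_map_on UNIV \<alpha>" "\<alpha> a = (1::real)" "\<forall>v\<in>C. \<alpha> v = 0"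
  obtains U where "open U" "x \<in> U"
    "\<forall>v\<in>U \<inter> affine hull (insert a C). 0 \<le> \<alpha> v \<longrightarrow> v \<in> convex hull (insert a C)"
proof -
  let ?V = "insert a C"
  have finV: "finite ?V" by (rule aff_independent_finite[OF V(1)])
  have "\<forall>w. \<exists>\<beta>::'a \<Rightarrow> real. affine_map_on UNIV \<beta> \<and> (\<forall>v\<in>?V. \<beta> v = (if v = w then 1 else 0))"
    using barycentric_coordinate_exists[OF V(1)] by (intro allI)
  from choice[OF this] obtain \<beta> :: "'a \<Rightarrow> 'a \<Rightarrow> real" where
    \<beta>: "\<forall>w. affine_map_on UNIV (\<beta> w) \<and> (\<forall>v\<in>?V. \<beta> w v = (if v = w then 1 else 0))" ..
  have \<beta>: "affine_map_on UNIV (\<beta> w)" "\<forall>v\<in>?V. \<beta> w v = (if v = w then 1 else 0)" for w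
    by (rule conjunct1[OF spec[OF \<beta>, of w]], rule conjunct2[OF spec[OF \<beta>, of w]])
  have eval: "\<beta> w (\<Sum>v\<in>D. u v *\<^sub>R v) = (if w \<in> D then u w else 0)"
    if "D \<subseteq> ?V" "sum u D = 1" for w D u
  proof -
    have fD: "finite D" using that(1) finV finite_subset by blast
    have "\<beta> w (\<Sum>v\<in>D. u v *\<^sub>R v) = (\<Sum>v\<in>D. u v *\<^sub>R \<beta> w v)"
      using affine_map_on_sum[OF \<beta>(1) fD _ _ that(2)] by simp
    also have "\<dots> = (\<Sum>v\<in>D. if w = v then u v else 0)"
      using that(1) \<beta>(2) by (intro sum.cong) auto
    finally show ?thesis using fD by simp
  qed
  define U where "U = (\<Inter>w\<in>C. \<beta> w -` {0<..})"
  have "open U"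
    unfolding U_def using finV affine_map_on_continuous[OF \<beta>(1)]
    by (intro open_INT ballI open_vimage) auto
  moreover have "x \<in> U"
  proof -
    have "\<not> affine_dependent C" using V(1) affine_independent_subset by blast
    then obtain u where u: "\<forall>v\<in>C. 0 < u v" "sum u C = 1" "(\<Sum>v\<in>C. u v *\<^sub>R v) = x"
      using x rel_interior_convex_hull_explicit[of C] by auto
    have "\<beta> w x = u w" if "w \<in> C" for w
      using eval[OF subset_insertI u(2), of w] u(3) that by simp
    then show ?thesis using u(1) by (simp add: U_def)
  qed
  moreover have "v \<in> convex hull ?V" if v: "v \<in> U" "v \<in> affine hull ?V" "0 \<le> \<alpha> v" for v
  proof -
    obtain u where u: "sum u ?V = 1" "(\<Sum>w\<in>?V. u w *\<^sub>R w) = v"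
      using v(2) affine_hull_finite[OF finV] by auto
    have "\<alpha> v = (\<Sum>w\<in>?V. u w *\<^sub>R \<alpha> w)"
      using affine_map_on_sum[OF \<alpha>(1) finV _ _ u(1)] u(2) by simp
    also have "\<dots> = u a" using finV \<alpha>(2,3) V(2) by simp
    finally have "0 \<le> u a" using v(3) by simp
    moreover have "0 \<le> u w" if "w \<in> C" for w
      using eval[OF subset_refl u(1), of w] u(2) that \<open>v \<in> U\<close> by (fastforce simp: U_def)
    ultimately show ?thesis
      using u finV convex_hull_finite[OF finV] by auto
  qed
  ultimately show ?thesis using that by blast
qed

text \<open>The two simplices may meet at an angle in the ambient space. Bending a flat along their
  common facet parametrizes their union near \<open>x\<close>, and invariance of domain shows that
  this union is all of \<open>M\<close> there.\<close>

lemma two_cofaces_cover_neighbourhood: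
  assumes c: "pl_chart_at d M x N \<phi>"
    and a: "\<not> affine_dependent (insert a C)" "a \<notin> C" "convex hull (insert a C) \<subseteq> M"
    and b: "\<not> affine_dependent (insert b C)" "b \<notin> C" "convex hull (insert b C) \<subseteq> M"
    and C: "card C = d" "x \<in> rel_interior (convex hull C)"
    and ab: "convex hull (insert a C) \<inter> convex hull (insert b C) \<subseteq> convex hull C"
  shows "\<phi> x \<in> rel_interior (\<phi> ` N)"
    and "\<exists>U. open U \<and> x \<in> U \<and> U \<inter> M \<subseteq> convex hull (insert a C) \<union> convex hull (insert b C)"
proof -
  obtain \<alpha> :: "'a \<Rightarrow> real" where \<alpha>: "affine_map_on UNIV \<alpha>" "\<alpha> a = 1" "\<forall>v\<in>C. \<alpha> v = 0"
    using facet_coordinate_exists[OF a(1,2)] by blast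
  obtain \<beta> :: "'a \<Rightarrow> real" where \<beta>: "affine_map_on UNIV \<beta>" "\<beta> b = 1" "\<forall>v\<in>C. \<beta> v = 0"
    using facet_coordinate_exists[OF b(1,2)] by blast
  obtain U1 where U1: "open U1" "x \<in> U1"
    "\<forall>v\<in>U1 \<inter> affine hull (insert a C). 0 \<le> \<alpha> v \<longrightarrow> v \<in> convex hull (insert a C)"
    using simplex_near_facet_point[OF a(1,2) C(2) \<alpha>] by blast
  obtain U2 where U2: "open U2" "x \<in> U2"
    "\<forall>v\<in>U2 \<inter> affine hull (insert b C). 0 \<le> \<beta> v \<longrightarrow> v \<in> convex hull (insert b C)"
    using simplex_near_facet_point[OF b(1,2) C(2) \<beta>] by blast
  let ?A = "affine hull (insert a C)" and ?B = "affine hull (insert b C)"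
  txt \<open>
    \<open>h\<close> unfolds the two simplices into the flat spanned by the first one: \<open>R\<close> fixes \<open>C\<close> and sends the
    reflection of \<open>a\<close> in \<open>x\<close> to \<open>b\<close>.
  \<close>
  define w where "w = 2 *\<^sub>R x - a - b"
  define R where "R v = v + \<alpha> v *\<^sub>R w" for v
  define h where "h v = v + min 0 (\<alpha> v) *\<^sub>R w" for v
  have xC: "x \<in> convex hull C" using C(2) rel_interior_subset by blast
  then have xaff: "x \<in> affine hull C" using convex_hull_subset_affine_hull by blast
  have zero: "\<alpha> v = 0" "\<beta> v = 0" if "v \<in> convex hull C" for v
    using affine_map_hull_mem[OF \<alpha>(1) affine_sing, of C 0 v] affine_map_hull_mem[OF \<beta>(1) affine_sing, of C 0 v]
      that \<alpha>(3) \<beta>(3) convex_hull_subset_affine_hull[of C] by auto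
  have R: "affine_map_on UNIV R"
  proof -
    obtain g k where g: "linear g" "\<And>v. \<alpha> v = g v + k" using \<alpha>(1) by (auto simp: affine_map_on_def)
    have "linear (\<lambda>v. v + g v *\<^sub>R w)"
      by (rule linearI) (simp_all add: linear_add[OF g(1)] linear_scale[OF g(1)] algebra_simps)
    then show ?thesis unfolding affine_map_on_def
      by (intro exI[of _ "\<lambda>v. v + g v *\<^sub>R w"] exI[of _ "k *\<^sub>R w"]) (auto simp: R_def g(2) algebra_simps)
  qed
  have Ra: "R a = 2 *\<^sub>R x - b" using \<alpha>(2) by (simp add: R_def w_def)
  have RC: "R v = v" if "v \<in> C" for v using \<alpha>(3) that by (simp add: R_def)
  have bB: "b \<in> ?B" by (simp add: hull_inc)
  have xB: "x \<in> ?B" using xaff hull_mono[of C "insert b C" affine] by blast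
  have RB: "R v \<in> ?B" if "v \<in> ?A" for v
  proof (rule affine_map_hull_mem[OF R _ _ that])
    fix v assume v: "v \<in> insert a C"
    have "2 *\<^sub>R x + (-1) *\<^sub>R b \<in> ?B" using mem_affine[OF affine_affine_hull xB bB, of 2 "-1"] by simp
    then have "R a \<in> ?B" using Ra by simp
    then show "R v \<in> ?B" using v RC by (auto simp: hull_inc)
  qed simp
  \<comment> \<open>\<open>R\<close> exchanges the two sides of the facet. Both sides are affine in
    \<open>v\<close>, so it suffices to compare them at \<open>a\<close> and on
    \<open>C\<close>.\<close>
  have \<beta>R: "\<beta> (R v) = - \<alpha> v" if "v \<in> ?A" for v
  proof -
    obtain g k where g: "linear g" "\<And>v. \<alpha> v = g v + k" using \<alpha>(1) by (auto simp: affine_map_on_def)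
    obtain g' k' where g': "linear g'" "\<And>v. \<beta> v = g' v + k'" using \<beta>(1) by (auto simp: affine_map_on_def)
    obtain g'' k'' where g'': "linear g''" "\<And>v. R v = g'' v + k''" using R by (auto simp: affine_map_on_def)
    have "linear (\<lambda>v. g' (g'' v) + g v)"
      using linear_compose[OF g''(1) g'(1)] g(1) by (intro linear_compose_add) (simp_all add: o_def)
    then have "affine_map_on UNIV (\<lambda>v. \<beta> (R v) + \<alpha> v)"
      unfolding affine_map_on_def
      by (intro exI[of _ "\<lambda>v. g' (g'' v) + g v"] exI[of _ "g' k'' + k' + k"])
        (auto simp: g(2) g'(2) g''(2) linear_add[OF g'(1)])
    moreover have "\<beta> (R v) + \<alpha> v \<in> {0}" if "v \<in> insert a C" for v
    proof (cases "v = a")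
      case True
      have "\<beta> (2 *\<^sub>R x - b) = 2 * \<beta> x - \<beta> b"
        by (simp add: g'(2) linear_diff[OF g'(1)] linear_scale[OF g'(1)])
      then show ?thesis using True Ra zero(2)[OF xC] \<alpha>(2) \<beta>(2) by simp
    next
      case False
      then show ?thesis using that RC \<alpha>(3) \<beta>(3) by auto
    qed
    ultimately have "\<beta> (R v) + \<alpha> v \<in> {0}"
      using affine_map_hull_mem[OF _ affine_sing _ that] by blast
    then show ?thesis by simp
  qed
  have conth: "continuous_on UNIV h"
    unfolding h_def using affine_map_on_continuous[OF \<alpha>(1)] by (intro continuous_intros)
  have hx: "h x = x" using zero(1)[OF xC] by (simp add: h_def)
  \<comment> \<open>The sign test for the first simplex is valid at \<open>v\<close>, the one for
    the second at \<open>h v\<close>.\<close>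
  define W where "W = ?A \<inter> (U1 \<inter> h -` U2)"
  have W: "openin (top_of_set ?A) W"
    unfolding W_def using U1(1) open_vimage[OF U2(1) conth] by (intro openin_open_Int open_Int)
  have xW: "x \<in> W"
    using hx U1(2) U2(2) xaff hull_mono[of C "insert a C" affine] by (auto simp: W_def)
  have pos: "h v = v \<and> v \<in> convex hull (insert a C)" if "v \<in> W" "0 \<le> \<alpha> v" for v
    using that U1(3) by (auto simp: W_def h_def)
  have neg: "h v = R v \<and> h v \<in> convex hull (insert b C) \<and> 0 < \<beta> (h v)" if "v \<in> W" "\<alpha> v < 0" for v
  proof -
    have "h v = R v" using that(2) by (simp add: h_def R_def)
    moreover have "R v \<in> ?B" "\<beta> (R v) = - \<alpha> v" using RB \<beta>R that(1) by (auto simp: W_def)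
    ultimately show ?thesis using that U2(3) by (auto simp: W_def)
  qed
  have him: "h ` W \<subseteq> convex hull (insert a C) \<union> convex hull (insert b C)"
    using pos neg by (metis Un_iff image_subsetI not_less)
  \<comment> \<open>A common value of the two sides would lie in both simplices, hence in the facet,
    where \<open>\<beta>\<close> vanishes; but \<open>\<beta>\<close> is positive at
    \<open>h v'\<close>.\<close>
  have ne: "h v \<noteq> h v'" if "v \<in> W" "v' \<in> W" "0 \<le> \<alpha> v" "\<alpha> v' < 0" for v v'
  proof
    assume "h v = h v'"
    then have "h v' \<in> convex hull C" using pos[OF that(1,3)] neg[OF that(2,4)] ab by auto
    then show False using zero(2) neg[OF that(2,4)] by fastforce
  qed
  have inj: "inj_on h W"
  proof (rule inj_onI)
    fix v v' assume v: "v \<in> W" "v' \<in> W" "h v = h v'"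
    consider "0 \<le> \<alpha> v" "0 \<le> \<alpha> v'" | "\<alpha> v < 0" "\<alpha> v' < 0"
      using ne[OF v(1,2)] ne[OF v(2,1)] v(3) by fastforce
    then show "v = v'"
    proof cases
      case 1
      then show ?thesis using pos v by metis
    next
      case 2
      then have "R v = R v'" using neg v by metis
      \<comment> \<open>\<open>R\<close> shifts \<open>v\<close> by a multiple of \<open>w\<close>
        that depends only on \<open>\<alpha> v\<close>, so equal values of \<open>\<alpha>\<close>
        cancel.\<close>
      then have "\<alpha> v = \<alpha> v'" using \<beta>R v(1,2) by (auto simp: W_def) (metis neg_equal_iff_equal)
      then show ?thesis using \<open>R v = R v'\<close> by (simp add: R_def)
    qed
  qed
  have dimA: "aff_dim ?A = int d"
    using aff_dim_affine_independent[OF a(1)] a(2) C(1) aff_independent_finite[OF a(1)]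
    by (simp add: aff_dim_affine_hull)
  have hM: "h ` W \<subseteq> M" using him a(3) b(3) by blast
  note inv = pl_chart_at_invariance_of_domain[OF c W affine_affine_hull dimA _ inj hM xW hx]
  have contW: "continuous_on W h" using conth continuous_on_subset by blast
  show "\<phi> x \<in> rel_interior (\<phi> ` N)" using inv(1)[OF contW] .
  show "\<exists>U. open U \<and> x \<in> U \<and> U \<inter> M \<subseteq> convex hull (insert a C) \<union> convex hull (insert b C)"
    using inv(2)[OF contW] him by (meson subset_trans)
qed

section \<open>Boundary facets of a triangulated manifold\<close>

lemma simplicial_complex_simplex:
  assumes "simplicial_complex T" "\<sigma> \<in> T"
  obtains n where "n simplex \<sigma>"
  using assms unfolding simplicial_complex_def by blast

lemma simplicial_complex_vertices:
  assumes "simplicial_complex T" "\<sigma> \<in> T"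
  shows "finite (simplex_vertices \<sigma>)" "\<not> affine_dependent (simplex_vertices \<sigma>)"
    "convex hull (simplex_vertices \<sigma>) = \<sigma>" "int (card (simplex_vertices \<sigma>)) = aff_dim \<sigma> + 1"
proof -
  obtain n where n: "n simplex \<sigma>" using simplicial_complex_simplex[OF assms] .
  note v = simplex_hull_vertices[OF n]
  show "finite (simplex_vertices \<sigma>)" "\<not> affine_dependent (simplex_vertices \<sigma>)"
    "convex hull (simplex_vertices \<sigma>) = \<sigma>" using v by simp_all
  have "aff_dim \<sigma> = aff_dim (simplex_vertices \<sigma>)"
    by (subst v(3)) (rule aff_dim_convex_hull)
  then show "int (card (simplex_vertices \<sigma>)) = aff_dim \<sigma> + 1"
    using aff_dim_affine_independent[OF v(2)] by simp
qed

lemma simplex_vertices_convex_hull: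
  assumes "\<not> affine_dependent C"
  shows "simplex_vertices (convex hull C) = C"
  using assms by (auto simp: simplex_vertices_def extreme_point_of_convex_hull_affine_independent)

lemma simplicial_complex_subset_face:
  assumes "simplicial_complex T" "\<sigma> \<in> T" "\<tau> \<in> T" "\<tau> \<subseteq> \<sigma>"
  shows "\<tau> face_of \<sigma>"
proof -
  have "\<sigma> \<inter> \<tau> face_of \<sigma>" using assms(1,2,3) unfolding simplicial_complex_def by blast
  then show ?thesis using assms(4) by (simp add: Int_absorb1)
qed

lemma simplicial_complex_subset_vertices:
  assumes "simplicial_complex T" "\<sigma> \<in> T" "\<tau> \<in> T" "\<tau> \<subseteq> \<sigma>"
  shows "simplex_vertices \<tau> \<subseteq> simplex_vertices \<sigma>"
  using extreme_point_of_face[OF simplicial_complex_subset_face[OF assms]]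
  by (auto simp: simplex_vertices_def)

lemma simplicial_complex_face:
  assumes "simplicial_complex T" "\<sigma> \<in> T" "\<tau> face_of \<sigma>"
  shows "\<tau> \<in> T"
  using assms unfolding simplicial_complex_def by blast

lemma simplicial_complex_hull_subset:
  assumes T: "simplicial_complex T" "\<sigma> \<in> T" and W: "W \<subseteq> simplex_vertices \<sigma>"
  shows "convex hull W \<in> T" "simplex_vertices (convex hull W) = W"
proof -
  note v = simplicial_complex_vertices[OF T]
  have "convex hull W face_of convex hull (simplex_vertices \<sigma>)"
    using face_of_convex_hull_affine_independent[OF v(2)] W by blast
  then show "convex hull W \<in> T" using simplicial_complex_face[OF T] v(3) by simp
  show "simplex_vertices (convex hull W) = W"
    by (rule simplex_vertices_convex_hull[OF affine_independent_subset[OF v(2) W]])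
qed

lemma simplicial_complex_Int:
  assumes "simplicial_complex T" "\<sigma> \<in> T" "\<tau> \<in> T"
  shows "\<sigma> \<inter> \<tau> \<in> T" "\<sigma> \<inter> \<tau> face_of \<sigma>" "\<sigma> \<inter> \<tau> face_of \<tau>"
proof -
  show f: "\<sigma> \<inter> \<tau> face_of \<sigma>" using assms unfolding simplicial_complex_def by blast
  have "\<tau> \<inter> \<sigma> face_of \<tau>" using assms unfolding simplicial_complex_def by blast
  then show "\<sigma> \<inter> \<tau> face_of \<tau>" by (simp add: Int_commute)
  show "\<sigma> \<inter> \<tau> \<in> T" by (rule simplicial_complex_face[OF assms(1,2) f])
qed

text \<open>The intersection is a face of \<tau> that meets its relative interior, hence all of
  \<tau>.\<close>

lemma simplicial_complex_carrier:
  assumes T: "simplicial_complex T" "\<sigma> \<in> T" "\<tau> \<in> T" and x: "x \<in> \<sigma>" "x \<in> rel_interior \<tau>"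
  shows "\<tau> \<subseteq> \<sigma>"
proof -
  have "\<sigma> \<inter> \<tau> \<inter> rel_interior \<tau> \<noteq> {}" using x rel_interior_subset by blast
  then have "\<tau> \<subseteq> \<sigma> \<inter> \<tau>" using subset_of_face_of[OF simplicial_complex_Int(3)[OF T] subset_refl] by blast
  then show ?thesis by blast
qed

section \<open>Cofaces of facets and the boundary of the manifold\<close>

definition cofaces :: "'a::euclidean_space set set \<Rightarrow> 'a set \<Rightarrow> 'a set set" where
  "cofaces T \<tau> = {\<sigma> \<in> T. aff_dim \<sigma> = aff_dim \<tau> + 1 \<and> \<tau> \<subseteq> \<sigma>}"

lemma coface_apex:
  assumes T: "simplicial_complex T" and \<tau>: "\<tau> \<in> T" and \<sigma>: "\<sigma> \<in> cofaces T \<tau>"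
  obtains a where "a \<notin> simplex_vertices \<tau>" "simplex_vertices \<sigma> = insert a (simplex_vertices \<tau>)"
proof -
  have s: "\<sigma> \<in> T" "aff_dim \<sigma> = aff_dim \<tau> + 1" "\<tau> \<subseteq> \<sigma>" using \<sigma> by (auto simp: cofaces_def)
  note v = simplicial_complex_vertices[OF T \<tau>] and w = simplicial_complex_vertices[OF T s(1)]
  have sub: "simplex_vertices \<tau> \<subseteq> simplex_vertices \<sigma>"
    by (rule simplicial_complex_subset_vertices[OF T s(1) \<tau> s(3)])
  have "card (simplex_vertices \<sigma> - simplex_vertices \<tau>) = 1"
    using card_Diff_subset[OF v(1) sub] v(4) w(4) s(2) by linarith
  then obtain a where "simplex_vertices \<sigma> - simplex_vertices \<tau> = {a}" by (auto simp: card_1_singleton_iff)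
  then show ?thesis using that[of a] sub by blast
qed

locale triangulated_manifold =
  fixes d :: nat and M :: "'a::euclidean_space set" and T
  assumes M: "pl_manifold d M" and T: "simplicial_complex T" "\<Union>T = M"
begin

lemma coface_nonempty:
  assumes \<tau>: "\<tau> \<in> T" "aff_dim \<tau> = int d - 1" and x: "x \<in> rel_interior \<tau>"
  shows "cofaces T \<tau> \<noteq> {}"
proof -
  have "x \<in> M" using x \<tau>(1) T(2) rel_interior_subset by blast
  then obtain \<sigma> where s: "\<sigma> \<in> T" "aff_dim \<sigma> = int d" "x \<in> \<sigma>"
    using manifold_triangulation_pure[OF M T] by blast
  then have "\<sigma> \<in> cofaces T \<tau>"
    using simplicial_complex_carrier[OF T(1) s(1) \<tau>(1) s(3) x] \<tau>(2) by (simp add: cofaces_def)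
  then show ?thesis by blast
qed

text \<open>Removing the finitely many simplices that miss \<open>x\<close> leaves an open set. By
  purity its points in \<open>M\<close> lie in \<open>d\<close>-simplices through \<open>x\<close>,
  and these contain \<tau>.\<close>

lemma cofaces_neighbourhood:
  assumes \<tau>: "\<tau> \<in> T" "aff_dim \<tau> = int d - 1" and x: "x \<in> rel_interior \<tau>"
  obtains U where "open U" "x \<in> U" "U \<inter> M \<subseteq> \<Union>(cofaces T \<tau>)"
proof -
  define U where "U = - \<Union>{\<sigma> \<in> T. x \<notin> \<sigma>}"
  have fin: "finite T" using T(1) by (simp add: simplicial_complex_def)
  have "closed \<sigma>" if "\<sigma> \<in> T" for \<sigma>
    using simplicial_complex_simplex[OF T(1) that] closed_simplex by metis
  then have "open U" using fin by (auto simp: U_def intro!: closed_Union)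
  moreover have "x \<in> U" by (auto simp: U_def)
  moreover have "y \<in> \<Union>(cofaces T \<tau>)" if y: "y \<in> U \<inter> M" for y
  proof -
    obtain \<sigma> where s: "\<sigma> \<in> T" "aff_dim \<sigma> = int d" "y \<in> \<sigma>"
      using manifold_triangulation_pure[OF M T] y by blast
    then have "x \<in> \<sigma>" using y by (auto simp: U_def)
    then have "\<sigma> \<in> cofaces T \<tau>"
      using simplicial_complex_carrier[OF T(1) s(1) \<tau>(1) _ x] \<tau>(2) s by (simp add: cofaces_def)
    then show ?thesis using s(3) by blast
  qed
  ultimately show ?thesis using that[of U] by blast
qed

text \<open>Two cofaces already fill a neighbourhood of \<open>x\<close>. A third one would have
  relative interior points there, and two different simplices of equal dimension cannot share such a
  point.\<close>

lemma two_cofaces: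
  assumes \<tau>: "\<tau> \<in> T" "aff_dim \<tau> = int d - 1" and x: "x \<in> rel_interior \<tau>"
    and \<sigma>: "\<sigma> \<in> cofaces T \<tau>" "\<sigma>' \<in> cofaces T \<tau>" "\<sigma> \<noteq> \<sigma>'"
  shows "x \<notin> pl_boundary d M" and "cofaces T \<tau> = {\<sigma>, \<sigma>'}"
proof -
  let ?C = "simplex_vertices \<tau>"
  note v = simplicial_complex_vertices[OF T(1) \<tau>(1)]
  have sT: "\<sigma> \<in> T" "\<sigma>' \<in> T" using \<sigma> by (auto simp: cofaces_def)
  note vs = simplicial_complex_vertices[OF T(1) sT(1)] and vs' = simplicial_complex_vertices[OF T(1) sT(2)]
  obtain a where a: "a \<notin> ?C" "simplex_vertices \<sigma> = insert a ?C" using coface_apex[OF T(1) \<tau>(1) \<sigma>(1)] .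
  obtain b where b: "b \<notin> ?C" "simplex_vertices \<sigma>' = insert b ?C" using coface_apex[OF T(1) \<tau>(1) \<sigma>(2)] .
  have "a \<noteq> b" using \<sigma>(3) a(2) b(2) vs(3) vs'(3) by metis
  have card: "card ?C = d" using v(4) \<tau>(2) by simp
  \<comment> \<open>The vertices of the intersection are common to both simplices, whose apexes
    \<open>a\<close> and \<open>b\<close> differ.\<close>
  have int: "\<sigma> \<inter> \<sigma>' \<subseteq> convex hull ?C"
  proof -
    note I = simplicial_complex_Int[OF T(1) sT]
    have "simplex_vertices (\<sigma> \<inter> \<sigma>') \<subseteq> insert a ?C" "simplex_vertices (\<sigma> \<inter> \<sigma>') \<subseteq> insert b ?C"
      using simplicial_complex_subset_vertices[OF T(1) sT(1) I(1)]
        simplicial_complex_subset_vertices[OF T(1) sT(2) I(1)] a(2) b(2) by auto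
    then have "simplex_vertices (\<sigma> \<inter> \<sigma>') \<subseteq> ?C" using \<open>a \<noteq> b\<close> a(1) by blast
    then have "convex hull (simplex_vertices (\<sigma> \<inter> \<sigma>')) \<subseteq> convex hull ?C" by (rule hull_mono)
    then show ?thesis using simplicial_complex_vertices(3)[OF T(1) I(1)] by simp
  qed
  have sa: "convex hull (insert a ?C) = \<sigma>" and sb: "convex hull (insert b ?C) = \<sigma>'"
    using a(2) b(2) vs(3) vs'(3) by simp_all
  have xM: "x \<in> M" using x \<tau>(1) T(2) rel_interior_subset by blast
  have sM: "\<sigma> \<subseteq> M" "\<sigma>' \<subseteq> M" using sT T(2) by auto
  have fold: "\<phi> x \<in> rel_interior (\<phi> ` N)" "\<exists>U. open U \<and> x \<in> U \<and> U \<inter> M \<subseteq> \<sigma> \<union> \<sigma>'"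
    if "pl_chart_at d M x N \<phi>" for N \<phi>
    using two_cofaces_cover_neighbourhood[OF that, of a ?C b] a b vs(2) vs'(2) v(3) sa sb sM card x int
    by simp_all
  show "x \<notin> pl_boundary d M"
    using fold(1) by (auto simp: pl_boundary_def rel_frontier_def)
  obtain N \<phi> where "pl_chart_at d M x N \<phi>" using M xM by (auto simp: pl_manifold_def)
  then obtain U where U: "open U" "x \<in> U" "U \<inter> M \<subseteq> \<sigma> \<union> \<sigma>'" using fold(2) by blast
  have "\<rho> = \<sigma> \<or> \<rho> = \<sigma>'" if \<rho>: "\<rho> \<in> cofaces T \<tau>" for \<rho>
  proof -
    have rT: "\<rho> \<in> T" "\<tau> \<subseteq> \<rho>" using \<rho> by (auto simp: cofaces_def)
    obtain n where "n simplex \<rho>" using simplicial_complex_simplex[OF T(1) rT(1)] .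
    then have "closure (rel_interior \<rho>) = \<rho>" 
      using convex_closure_rel_interior[of \<rho>] convex_simplex closed_simplex closure_closed by metis
    then have "x \<in> closure (rel_interior \<rho>)" using x rT(2) rel_interior_subset by blast
    then obtain y where y: "y \<in> rel_interior \<rho>" "y \<in> U"
      using U(1,2) open_Int_closure_eq_empty[OF U(1), of "rel_interior \<rho>"] by blast
    then have "y \<in> \<sigma> \<union> \<sigma>'" using U(3) rT(1) T(2) rel_interior_subset by blast
    moreover have "\<rho> = \<kappa>" if "y \<in> \<kappa>" "\<kappa> \<in> cofaces T \<tau>" for \<kappa>
    proof -
      have kT: "\<kappa> \<in> T" "aff_dim \<kappa> = aff_dim \<rho>" using that(2) \<rho> by (auto simp: cofaces_def)
      have "\<rho> face_of \<kappa>"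
        using simplicial_complex_subset_face[OF T(1) kT(1) rT(1)]
          simplicial_complex_carrier[OF T(1) kT(1) rT(1) that(1) y(1)] by blast
      moreover obtain m where "m simplex \<kappa>" using simplicial_complex_simplex[OF T(1) kT(1)] .
      ultimately show ?thesis using face_of_aff_dim_lt[of \<kappa> \<rho>] convex_simplex kT(2) by fastforce
    qed
    ultimately show ?thesis using \<sigma>(1,2) by blast
  qed
  then show "cofaces T \<tau> = {\<sigma>, \<sigma>'}" using \<sigma>(1,2) by blast
qed

text \<open>Off the boundary, an inverse chart would map an open piece of a \<open>d\<close>-flat
  injectively into \<sigma>. Its image is open in the flat of \<sigma>, which places
  \<open>x\<close> in the relative interior of \<sigma> although it lies on the proper face
  \<tau>.\<close>

lemma one_coface:
  assumes \<tau>: "\<tau> \<in> T" "aff_dim \<tau> = int d - 1" and x: "x \<in> rel_interior \<tau>"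
    and \<sigma>: "cofaces T \<tau> = {\<sigma>}"
  shows "x \<in> pl_boundary d M"
proof (rule ccontr)
  assume nb: "x \<notin> pl_boundary d M"
  have xM: "x \<in> M" using x \<tau>(1) T(2) rel_interior_subset by blast
  obtain N \<phi> where c: "pl_chart_at d M x N \<phi>" using M xM by (auto simp: pl_manifold_def)
  note cf = pl_chart_at_facts[OF c]
  have int: "\<phi> x \<in> rel_interior (\<phi> ` N)"
    using nb pl_boundary_chart_iff[OF c xM] cf(7) cf(8)[OF xM] by (auto simp: rel_frontier_def)
  obtain W h where W: "openin (top_of_set (affine hull (\<phi> ` N))) W" "continuous_on W h" "inj_on h W"
      "h ` W \<subseteq> N" "\<phi> x \<in> W" "h (\<phi> x) = x"
    using pl_chart_at_interior_param[OF c xM int] .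
  obtain U where U: "open U" "x \<in> U" "U \<inter> M \<subseteq> \<sigma>"
    using cofaces_neighbourhood[OF \<tau> x] \<sigma> by auto
  have sT: "\<sigma> \<in> T" "aff_dim \<sigma> = int d" "\<tau> \<subseteq> \<sigma>" using \<sigma> \<tau>(2) by (auto simp: cofaces_def)
  define W' where "W' = W \<inter> h -` U"
  have him: "h ` W' \<subseteq> \<sigma>" using W(4) cf(4) U(3) by (auto simp: W'_def)
  have "openin (top_of_set W) W'"
    unfolding W'_def by (rule continuous_openin_preimage_gen[OF W(2) U(1)])
  then have oW': "openin (top_of_set (affine hull (\<phi> ` N))) W'" using W(1) openin_trans by blast
  have "openin (top_of_set (affine hull \<sigma>)) (h ` W')"
  proof (rule invariance_of_domain_affine_sets[OF oW'])
    show "continuous_on W' h" using W(2) by (rule continuous_on_subset) (auto simp: W'_def)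
    show "inj_on h W'" using W(3) by (rule inj_on_subset) (auto simp: W'_def)
    show "h \<in> W' \<rightarrow> affine hull \<sigma>" using him by (auto intro!: hull_inc)
    show "aff_dim (affine hull \<sigma>) \<le> aff_dim (affine hull (\<phi> ` N))"
      using sT(2) cf(5) by (simp add: aff_dim_affine_hull)
  qed simp_all
  then have "h ` W' \<subseteq> rel_interior \<sigma>" by (rule rel_interior_maximal[OF him])
  moreover have "x \<in> h ` W'" using W(5,6) U(2) by (force simp: W'_def)
  ultimately have "x \<in> rel_interior \<sigma>" by blast
  moreover have "\<tau> \<inter> rel_interior \<sigma> = {}"
  proof (rule face_of_disjoint_rel_interior)
    show "\<tau> face_of \<sigma>" by (rule simplicial_complex_subset_face[OF T(1) sT(1) \<tau>(1) sT(3)])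
    show "\<tau> \<noteq> \<sigma>" using sT(2) \<tau>(2) by auto
  qed
  ultimately show False using x rel_interior_subset by blast
qed

text \<open>Every facet has one or two cofaces, but only the parity matters below.\<close>

definition odd_facets :: "'a set set" where
  "odd_facets = {\<tau> \<in> T. aff_dim \<tau> = int d - 1 \<and> odd (card (cofaces T \<tau>))}"

text \<open>Oddness leaves exactly one coface, so the relative interior lies in the boundary; the
  rest of the facet follows because the boundary is closed in \<open>M\<close>.\<close>

lemma odd_facets_subset_boundary:
  assumes \<tau>: "\<tau> \<in> odd_facets"
  shows "\<tau> \<subseteq> pl_boundary d M"
proof
  have t: "\<tau> \<in> T" "aff_dim \<tau> = int d - 1" "odd (card (cofaces T \<tau>))"
    using \<tau> by (auto simp: odd_facets_def)
  have ri: "rel_interior \<tau> \<subseteq> pl_boundary d M"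
  proof
    fix x assume x: "x \<in> rel_interior \<tau>"
    have "cofaces T \<tau> \<noteq> {}" using t(3) by auto
    then obtain \<sigma> where s: "\<sigma> \<in> cofaces T \<tau>" by blast
    have "\<sigma>' = \<sigma>" if "\<sigma>' \<in> cofaces T \<tau>" for \<sigma>'
    proof (rule ccontr)
      assume "\<sigma>' \<noteq> \<sigma>"
      then have "card (cofaces T \<tau>) = 2"
        using two_cofaces(2)[OF t(1,2) x that s] by simp
      then show False using t(3) by simp
    qed
    then have "cofaces T \<tau> = {\<sigma>}" using s by blast
    then show "x \<in> pl_boundary d M" using one_coface[OF t(1,2) x] by blast
  qed
  fix x assume x: "x \<in> \<tau>"
  obtain n where "n simplex \<tau>" using simplicial_complex_simplex[OF T(1) t(1)] .
  then have "closure (rel_interior \<tau>) = \<tau>"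
    using convex_closure_rel_interior[of \<tau>] convex_simplex closed_simplex closure_closed by metis
  then have "x \<in> closure (pl_boundary d M)" using x closure_mono[OF ri] by blast
  then show "x \<in> pl_boundary d M" using closed_pl_boundary[OF M] x t(1) T(2) by blast
qed

text \<open>The odd facets form a closed set. Off it, \<open>x\<close> could be moved along a facet
  of the model simplex to a boundary point \<open>y\<close> lying in no simplex of dimension below
  \<open>d - 1\<close>. Such a \<open>y\<close> is in the relative interior of a facet, which has a
  single coface and is therefore odd.\<close>

lemma boundary_subset_odd_facets:
  assumes x: "x \<in> pl_boundary d M"
  shows "x \<in> \<Union>odd_facets"
proof (rule ccontr)
  assume no: "x \<notin> \<Union>odd_facets"
  have xM: "x \<in> M" using x by (simp add: pl_boundary_def)
  have fin: "finite T" using T(1) by (simp add: simplicial_complex_def)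
  have cl: "closed \<sigma>" if "\<sigma> \<in> T" for \<sigma>
    using simplicial_complex_simplex[OF T(1) that] closed_simplex by metis
  obtain N \<phi> where c: "pl_chart_at d M x N \<phi>" using M xM by (auto simp: pl_manifold_def)
  note cf = pl_chart_at_facts[OF c]
  obtain U where U: "open U" "x \<in> U" "U \<inter> M \<subseteq> N" "\<And>x'. x' \<in> U \<Longrightarrow> pl_chart_at d M x' N \<phi>"
    using pl_chart_at_near[OF c] by blast
  define V where "V = U - \<Union>odd_facets"
  have "closed (\<Union>odd_facets)" using fin cl by (auto simp: odd_facets_def intro!: closed_Union)
  then have V: "open V" "x \<in> V" using U(1,2) no by (auto simp: V_def)
  obtain e where e: "0 < e" "\<forall>y\<in>N. \<phi> y \<in> ball (\<phi> x) e \<longrightarrow> y \<in> V"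
    using pl_chart_at_small_ball[OF c xM V] .
  have simp: "int d simplex (\<phi> ` N)" using c by (simp add: pl_chart_at_def)
  have rf: "rel_frontier (\<phi> ` N) = \<Union>{F. F facet_of (\<phi> ` N)}"
    by (rule rel_frontier_of_polyhedron[OF simplex_imp_polyhedron[OF simp]])
  have "\<phi> x \<in> rel_frontier (\<phi> ` N)" using pl_boundary_chart_iff[OF c xM] x by blast
  then obtain F where F: "F facet_of (\<phi> ` N)" "\<phi> x \<in> F" using rf by auto
  have Ff: "F face_of \<phi> ` N" "aff_dim F = int d - 1" using F(1) cf(5) by (auto simp: facet_of_def)
  have Fd: "aff_dim F = int d - 1" "convex F" "F \<subseteq> \<phi> ` N"
    using Ff(2) face_of_imp_convex[OF Ff(1)] face_of_imp_subset[OF Ff(1)] by auto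
  let ?C = "F \<inter> ball (\<phi> x) e"
  have ne: "?C \<noteq> {}" using F(2) e(1) by fastforce
  have dim: "aff_dim ?C = int d - 1" using aff_dim_convex_Int_open[OF Fd(2) _ ne] Fd(1) by simp
  obtain y where y: "y \<in> N" "\<phi> y \<in> ?C" "y \<notin> \<Union>{\<sigma> \<in> T. aff_dim \<sigma> < int d - 1}"
    by (rule pl_chart_at_avoid_low_dim[OF c, of ?C "{\<sigma> \<in> T. aff_dim \<sigma> < int d - 1}"])
      (use Fd ne dim fin in \<open>auto intro: convex_Int\<close>)
  have yM: "y \<in> M" using y(1) cf(4) by blast
  have yV: "y \<in> V" using e(2) y(1,2) by blast
  then have "pl_chart_at d M y N \<phi>" using U(4) by (simp add: V_def)
  moreover have "\<phi> y \<in> rel_frontier (\<phi> ` N)" using rf F(1) y(2) by blast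
  ultimately have yb: "y \<in> pl_boundary d M" using yM by (auto simp: pl_boundary_def)
  obtain \<sigma> where s: "\<sigma> \<in> T" "aff_dim \<sigma> = int d" "y \<in> \<sigma>"
    using manifold_triangulation_pure[OF M T yM] by blast
  \<comment> \<open>Used twice: to descend from a \<open>d\<close>-simplex to a facet through
    \<open>y\<close>, and to exclude a descent to dimension \<open>d - 2\<close>.\<close>
  have facet: "\<exists>\<rho>\<in>T. aff_dim \<rho> = aff_dim \<kappa> - 1 \<and> y \<in> \<rho>"
    if k: "\<kappa> \<in> T" "y \<in> \<kappa>" "y \<notin> rel_interior \<kappa>" for \<kappa>
  proof -
    obtain n where n: "n simplex \<kappa>" using simplicial_complex_simplex[OF T(1) k(1)] .
    have "y \<in> \<Union>{F. F facet_of \<kappa>}"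
      using rel_boundary_of_polyhedron[OF simplex_imp_polyhedron[OF n]] k(2,3) by blast
    then obtain \<rho> where "\<rho> facet_of \<kappa>" "y \<in> \<rho>" by blast
    then show ?thesis using simplicial_complex_face[OF T(1) k(1), of \<rho>] by (auto simp: facet_of_def)
  qed
  have "\<sigma> \<subseteq> M" using s(1) T(2) by blast
  then have "y \<notin> rel_interior \<sigma>" using rel_interior_simplex_not_pl_boundary[OF _ s(2)] yb by blast
  then obtain \<tau> where t: "\<tau> \<in> T" "aff_dim \<tau> = int d - 1" "y \<in> \<tau>" using facet[OF s(1,3)] s(2) by auto
  have yt: "y \<in> rel_interior \<tau>"
  proof (rule ccontr)
    assume "y \<notin> rel_interior \<tau>"
    from facet[OF t(1,3) this] obtain \<rho> where "\<rho> \<in> T" "aff_dim \<rho> = int d - 1 - 1" "y \<in> \<rho>"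
      using t(2) by auto
    then show False using y(3) by auto
  qed
  obtain \<kappa> where k: "\<kappa> \<in> cofaces T \<tau>" using coface_nonempty[OF t(1,2) yt] by blast
  have "\<kappa>' = \<kappa>" if "\<kappa>' \<in> cofaces T \<tau>" for \<kappa>'
    using two_cofaces(1)[OF t(1,2) yt that k] yb by blast
  then have "cofaces T \<tau> = {\<kappa>}" using k by blast
  then have "\<tau> \<in> odd_facets" using t(1,2) by (simp add: odd_facets_def)
  then show False using yV t(3) by (auto simp: V_def)
qed

end

section \<open>Counting facets along a ray\<close>

text \<open>The coefficients are indexed by \<open>V\<close> and not by its image, because different
  vertices may carry the same label.\<close>

lemma convex_hull_image_finite:
  fixes q :: "'v \<Rightarrow> 'b::real_vector"
  assumes "finite V"
  shows "convex hull (q ` V) = {x. \<exists>u. (\<forall>v\<in>V. 0 \<le> u v) \<and> sum u V = 1 \<and> (\<Sum>v\<in>V. u v *\<^sub>R q v) = x}"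
    (is "_ = ?R")
proof
  show "convex hull (q ` V) \<subseteq> ?R"
  proof (rule hull_minimal)
    show "q ` V \<subseteq> ?R"
    proof
      fix x assume "x \<in> q ` V"
      then obtain w where w: "w \<in> V" "x = q w" by blast
      have "(\<Sum>v\<in>V. (if v = w then 1 else 0) *\<^sub>R q v) = (\<Sum>v\<in>V. if v = w then q v else 0)"
        by (intro sum.cong) auto
      then show "x \<in> ?R"
        using w assms by (intro CollectI exI[of _ "\<lambda>v. if v = w then 1 else 0"]) simp
    qed
    show "convex ?R"
    proof (rule convexI)
      fix x y and s t :: real
      assume st: "0 \<le> s" "0 \<le> t" "s + t = 1" and "x \<in> ?R" "y \<in> ?R"
      then obtain a b where a: "\<forall>v\<in>V. 0 \<le> a v" "sum a V = 1" "(\<Sum>v\<in>V. a v *\<^sub>R q v) = x"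
        and b: "\<forall>v\<in>V. 0 \<le> b v" "sum b V = 1" "(\<Sum>v\<in>V. b v *\<^sub>R q v) = y" by blast
      have "(\<Sum>v\<in>V. (s * a v + t * b v) *\<^sub>R q v) = s *\<^sub>R x + t *\<^sub>R y"
        by (simp add: a(3)[symmetric] b(3)[symmetric] algebra_simps sum.distrib scaleR_right.sum)
      moreover have "(\<Sum>v\<in>V. s * a v + t * b v) = 1"
        using a(2) b(2) st(3) by (simp add: sum.distrib sum_distrib_left[symmetric])
      ultimately show "s *\<^sub>R x + t *\<^sub>R y \<in> ?R"
        using st a(1) b(1) by (intro CollectI exI[of _ "\<lambda>v. s * a v + t * b v"]) simp
    qed
  qed
  show "?R \<subseteq> convex hull (q ` V)"
    using convex_sum[OF assms convex_convex_hull, of _ q "q ` V"] by (auto simp: hull_inc)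
qed

text \<open>Points of the simplex over the ray solve \<open>d + 1\<close> linear equations in
  \<open>d + 2\<close> nonnegative unknowns: the barycentric coordinates and the ray parameter. The
  ray hits the image of the facet opposite \<open>v\<close> exactly when some solution vanishes at
  coordinate \<open>v\<close>. Passing to coefficients also covers degenerate images.\<close>

lemma even_card_facets_hit:
  fixes q :: "'v \<Rightarrow> 'b::euclidean_space"
  assumes V: "finite V" "card V = DIM('b) + 1" and u: "u \<noteq> 0"
    and edge: "\<And>v w t. v \<in> V \<Longrightarrow> w \<in> V \<Longrightarrow> v \<noteq> w \<Longrightarrow> 0 \<le> t \<Longrightarrow> y + t *\<^sub>R u \<notin> convex hull (q ` (V - {v, w}))"
    and facet: "\<And>v. v \<in> V \<Longrightarrow> y \<notin> convex hull (q ` (V - {v}))"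
    and no: "y \<notin> convex hull (q ` V)"
  shows "even (card {v \<in> V. \<exists>t\<ge>0. y + t *\<^sub>R u \<in> convex hull (q ` (V - {v}))})"
proof -
  txt \<open>The coordinate \<open>None\<close> is the ray parameter; it vanishes on the solutions representing \<open>y\<close> itself.\<close>
  define J where "J = insert None (Some ` V)"
  define w :: "'v option \<Rightarrow> 'b \<times> real" where "w j = (case j of None \<Rightarrow> (- u, 0) | Some v \<Rightarrow> (q v, 1))" for j
  have J: "finite J" "DIM('b \<times> real) < card J"
    using V by (auto simp: J_def card_image)
  have sumJ: "(\<Sum>j\<in>J. l j *\<^sub>R w j)
      = ((\<Sum>v\<in>V. l (Some v) *\<^sub>R q v) - l None *\<^sub>R u, \<Sum>v\<in>V. l (Some v))" for l
  proof -
    have "(\<Sum>j\<in>J. l j *\<^sub>R w j) = l None *\<^sub>R w None + (\<Sum>v\<in>V. l (Some v) *\<^sub>R w (Some v))"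
      unfolding J_def using V(1) by (subst sum.insert) (auto simp: sum.reindex)
    also have "\<dots> = ((\<Sum>v\<in>V. l (Some v) *\<^sub>R q v) - l None *\<^sub>R u, \<Sum>v\<in>V. l (Some v))"
      by (simp add: w_def prod_eq_iff fst_sum snd_sum)
    finally show ?thesis .
  qed
  define S where "S l \<longleftrightarrow> (\<forall>j\<in>J. 0 \<le> l j) \<and> (\<Sum>j\<in>J. l j *\<^sub>R w j) = (y, 1)" for l
  have S: "S l \<longleftrightarrow> 0 \<le> l None \<and> (\<forall>v\<in>V. 0 \<le> l (Some v)) \<and> (\<Sum>v\<in>V. l (Some v)) = 1
      \<and> (\<Sum>v\<in>V. l (Some v) *\<^sub>R q v) = y + l None *\<^sub>R u" for l
    unfolding S_def sumJ by (auto simp: J_def algebra_simps)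
  have mem: "y + l None *\<^sub>R u \<in> convex hull (q ` W)"
    if "S l" "W \<subseteq> V" "\<And>v. v \<in> V - W \<Longrightarrow> l (Some v) = 0" for l W
  proof -
    have "(\<Sum>v\<in>W. l (Some v)) = (\<Sum>v\<in>V. l (Some v))"
      "(\<Sum>v\<in>W. l (Some v) *\<^sub>R q v) = (\<Sum>v\<in>V. l (Some v) *\<^sub>R q v)"
      using that V(1) by (intro sum.mono_neutral_left; simp)+
    then show ?thesis
      using that(1,2) finite_subset[OF that(2) V(1)] unfolding S
      by (subst convex_hull_image_finite) (auto intro!: exI[of _ "\<lambda>v. l (Some v)"])
  qed
  have "even (card {j \<in> J. \<exists>l. ((\<forall>j\<in>J. 0 \<le> l j) \<and> (\<Sum>j\<in>J. l j *\<^sub>R w j) = (y, 1)) \<and> l j = 0})"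
  proof (rule even_card_vanishing_coordinates[OF J])
    \<comment> \<open>The second component forces the nonnegative weights to sum to zero and so to
      vanish; what remains is a multiple of \<open>u\<close>, which is nonzero.\<close>
    fix k j assume k: "(\<forall>j\<in>J. 0 \<le> k j) \<and> (\<Sum>j\<in>J. k j *\<^sub>R w j) = 0" and j: "j \<in> J"
    have "(\<Sum>v\<in>V. k (Some v)) = 0" and s: "(\<Sum>v\<in>V. k (Some v) *\<^sub>R q v) = k None *\<^sub>R u"
      using k unfolding sumJ by (auto simp: prod_eq_iff)
    then have z: "\<forall>v\<in>V. k (Some v) = 0"
      using k V(1) by (subst (asm) sum_nonneg_eq_0_iff) (auto simp: J_def)
    then have "k None = 0" using s u by simp
    then show "k j = 0" using z j by (auto simp: J_def)
  next
    fix l i j assume l: "(\<forall>j\<in>J. 0 \<le> l j) \<and> (\<Sum>j\<in>J. l j *\<^sub>R w j) = (y, 1)"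
      and ij: "i \<in> J" "j \<in> J" "l i = 0" "l j = 0"
    have Sl: "S l" using l by (simp add: S_def)
    then have l0: "0 \<le> l None" by (simp add: S)
    show "i = j"
    proof (rule ccontr)
      assume "i \<noteq> j"
      \<comment> \<open>Two vanishing vertex coordinates put a ray point into a codimension-two
        face; one of them together with \<open>None\<close> puts \<open>y\<close> into a
        facet.\<close>
      then consider v w where "v \<in> V" "w \<in> V" "v \<noteq> w" "l (Some v) = 0" "l (Some w) = 0"
        | v where "v \<in> V" "l (Some v) = 0" "l None = 0"
        using ij by (auto simp: J_def)
      then show False
      proof cases
        case 1
        then have "y + l None *\<^sub>R u \<in> convex hull (q ` (V - {v, w}))" by (intro mem[OF Sl]) auto
        then show False using edge[OF 1(1-3) l0] by blast
      next
        case 2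
        then have "y + l None *\<^sub>R u \<in> convex hull (q ` (V - {v}))" by (intro mem[OF Sl]) auto
        then show False using facet[OF 2(1)] 2(3) by simp
      qed
    qed
  qed
  then have ev: "even (card {j \<in> J. \<exists>l. S l \<and> l j = 0})" by (simp add: S_def)
  \<comment> \<open>Here the assumption that \<open>y\<close> is not covered removes
    \<open>None\<close> from the even count.\<close>
  have none: "l None \<noteq> 0" if "S l" for l
    using mem[OF that subset_refl] no by auto
  have hit: "(\<exists>l. S l \<and> l (Some v) = 0) \<longleftrightarrow> (\<exists>t\<ge>0. y + t *\<^sub>R u \<in> convex hull (q ` (V - {v})))" (is "?A \<longleftrightarrow> ?B")
    if v: "v \<in> V" for v
  proof
    assume ?A
    then obtain l where l: "S l" "l (Some v) = 0" by blast
    then have "y + l None *\<^sub>R u \<in> convex hull (q ` (V - {v}))" by (intro mem) auto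
    then show ?B using l(1) by (auto simp: S)
  next
    assume ?B
    then obtain t a where a: "0 \<le> t" "\<forall>w\<in>V - {v}. 0 \<le> a w" "sum a (V - {v}) = 1"
        "(\<Sum>w\<in>V - {v}. a w *\<^sub>R q w) = y + t *\<^sub>R u"
      using V(1) by (subst (asm) convex_hull_image_finite) auto
    define l where "l j = (case j of None \<Rightarrow> t | Some w \<Rightarrow> if w = v then 0 else a w)" for j
    have "(\<Sum>w\<in>V. l (Some w)) = sum a (V - {v})"
      "(\<Sum>w\<in>V. l (Some w) *\<^sub>R q w) = (\<Sum>w\<in>V - {v}. a w *\<^sub>R q w)"
      using v V(1) by (simp_all add: sum.remove[of V v] l_def)
    then have "S l" using a by (auto simp: S l_def)
    then show ?A by (intro exI[of _ l]) (simp add: l_def)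
  qed
  have "{j \<in> J. \<exists>l. S l \<and> l j = 0} = Some ` {v \<in> V. \<exists>l. S l \<and> l (Some v) = 0}"
    using none by (auto simp: J_def)
  also have "\<dots> = Some ` {v \<in> V. \<exists>t\<ge>0. y + t *\<^sub>R u \<in> convex hull (q ` (V - {v}))}"
    using hit by (intro arg_cong[of _ _ "image Some"] Collect_cong conj_cong refl)
  finally have "{j \<in> J. \<exists>l. S l \<and> l j = 0}
      = Some ` {v \<in> V. \<exists>t\<ge>0. y + t *\<^sub>R u \<in> convex hull (q ` (V - {v}))}" .
  then show ?thesis using ev by (simp add: card_image)
qed

text \<open>By Caratheodory \<open>z\<close> is in the hull of at most \<open>aff_dim + 1\<close> of
  the points; minimality makes these all the points, which are therefore independent. A point of a
  simplex off all facets is in its relative interior.\<close>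

lemma minimal_convex_hull:
  fixes q :: "'v \<Rightarrow> 'b::euclidean_space"
  assumes V: "finite V" and z: "z \<in> convex hull (q ` V)"
    and min: "\<And>v. v \<in> V \<Longrightarrow> z \<notin> convex hull (q ` (V - {v}))"
  shows "inj_on q V" "\<not> affine_dependent (q ` V)" "z \<in> rel_interior (convex hull (q ` V))"
proof -
  show inj: "inj_on q V"
  proof (rule inj_onI, rule ccontr)
    fix v w assume vw: "v \<in> V" "w \<in> V" "q v = q w" "v \<noteq> w"
    then have "q ` (V - {v}) = q ` V" by (auto simp: image_iff)
    then show False using min[OF vw(1)] z by simp
  qed
  have min': "z \<notin> convex hull S" if "S \<subset> q ` V" for S
  proof
    assume "z \<in> convex hull S"
    obtain v where v: "v \<in> V" "q v \<notin> S" using \<open>S \<subset> q ` V\<close> by blast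
    then have "S \<subseteq> q ` (V - {v})" using \<open>S \<subset> q ` V\<close> by blast
    then show False using min[OF v(1)] hull_mono[of S _ convex] \<open>z \<in> convex hull S\<close> by blast
  qed
  obtain S where S: "S \<subseteq> q ` V" "card S \<le> aff_dim (q ` V) + 1" "z \<in> convex hull S"
    using z caratheodory_aff_dim[of "q ` V"] by auto
  then have "S = q ` V" using min' by blast
  then have "aff_dim (q ` V) = int (card (q ` V)) - 1"
    using S(2) aff_dim_le_card[of "q ` V"] V by simp
  then show ind: "\<not> affine_dependent (q ` V)"
    using V by (simp add: affine_independent_iff_card)
  have "z \<notin> convex hull (q ` V - {a})" if "a \<in> q ` V" for a
    using min' that by blast
  then show "z \<in> rel_interior (convex hull (q ` V))"
    using z rel_boundary_of_convex_hull[OF ind] by blast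
qed

section \<open>The label map on simplices, and rays meeting the frontier of a convex set\<close>

lemma label_map_affine_on:
  assumes "simplicial_complex T" "\<sigma> \<in> T"
  shows "affine_map_on \<sigma> (label_map T p L)"
    "v \<in> simplex_vertices \<sigma> \<Longrightarrow> label_map T p L v = p (L v)"
  using label_map[OF assms(1), of p L] assms(2)
  by (auto simp: is_pl_extension_def complex_vertices_def)

lemma label_map_sum:
  assumes T: "simplicial_complex T" "\<sigma> \<in> T"
    and u: "\<forall>v\<in>simplex_vertices \<sigma>. 0 \<le> u v" "sum u (simplex_vertices \<sigma>) = 1"
  shows "label_map T p L (\<Sum>v\<in>simplex_vertices \<sigma>. u v *\<^sub>R v) = (\<Sum>v\<in>simplex_vertices \<sigma>. u v *\<^sub>R p (L v))"
proof -
  note v = simplicial_complex_vertices[OF T]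
  have mem: "(\<Sum>v\<in>simplex_vertices \<sigma>. u v *\<^sub>R v) \<in> \<sigma>"
    using u convex_hull_finite[OF v(1)] v(3) by blast
  have "simplex_vertices \<sigma> \<subseteq> \<sigma>" by (auto simp: simplex_vertices_def extreme_point_of_def)
  then have "label_map T p L (\<Sum>v\<in>simplex_vertices \<sigma>. u v *\<^sub>R v)
      = (\<Sum>v\<in>simplex_vertices \<sigma>. u v *\<^sub>R label_map T p L v)"
    by (rule affine_map_on_sum[OF label_map_affine_on(1)[OF T] v(1) _ mem u(2)])
  also have "\<dots> = (\<Sum>v\<in>simplex_vertices \<sigma>. u v *\<^sub>R p (L v))"
    using label_map_affine_on(2)[OF T] by (intro sum.cong) auto
  finally show ?thesis .
qed

lemma label_map_image:
  assumes T: "simplicial_complex T" "\<sigma> \<in> T"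
  shows "label_map T p L ` \<sigma> = convex hull ((\<lambda>v. p (L v)) ` simplex_vertices \<sigma>)"
proof -
  note v = simplicial_complex_vertices[OF T]
  let ?V = "simplex_vertices \<sigma>"
  have "label_map T p L ` \<sigma> = label_map T p L `
      {x. \<exists>u. (\<forall>v\<in>?V. 0 \<le> u v) \<and> sum u ?V = 1 \<and> (\<Sum>v\<in>?V. u v *\<^sub>R v) = x}"
    using convex_hull_finite[OF v(1)] v(3) by simp
  also have "\<dots> = {label_map T p L (\<Sum>v\<in>?V. u v *\<^sub>R v) |u. (\<forall>v\<in>?V. 0 \<le> u v) \<and> sum u ?V = 1}"
    by blast
  also have "\<dots> = {\<Sum>v\<in>?V. u v *\<^sub>R p (L v) |u. (\<forall>v\<in>?V. 0 \<le> u v) \<and> sum u ?V = 1}"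
    by (intro Collect_cong iff_exI) (auto simp: label_map_sum[OF T])
  also have "\<dots> = convex hull ((\<lambda>v. p (L v)) ` ?V)"
    unfolding convex_hull_image_finite[OF v(1)] by blast
  finally show ?thesis .
qed

text \<open>Of two frontier points on a ray from an interior point, the nearer one would lie
  strictly between that point and a point of the closure, hence in the interior.\<close>

lemma ray_frontier_unique:
  fixes P :: "'b::euclidean_space set"
  assumes P: "convex P" and y: "y \<in> interior P" and z: "z \<in> frontier P"
    and t: "0 \<le> t" "y + t *\<^sub>R (z - y) \<in> frontier P"
  shows "t = 1"
proof -
  have zc: "z \<in> closure P" "z \<notin> interior P" using z by (auto simp: frontier_def)
  let ?x = "y + t *\<^sub>R (z - y)"
  have xc: "?x \<in> closure P" "?x \<notin> interior P" using t(2) by (auto simp: frontier_def)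
  have "t \<noteq> 0" using xc y by auto
  have "z \<noteq> y" "?x \<noteq> y" using y zc xc by auto
  have "\<not> t < 1"
  proof
    assume "t < 1"
    then have "?x \<in> open_segment y z"
      unfolding in_segment using \<open>z \<noteq> y\<close> t(1) \<open>t \<noteq> 0\<close>
      by (intro conjI exI[of _ t]) (auto simp: algebra_simps)
    then show False using in_interior_closure_convex_segment[OF P y zc(1)] xc(2) by blast
  qed
  moreover have "\<not> 1 < t"
  proof
    assume "1 < t"
    define s where "s = 1 / t"
    have s: "s * t = 1" "0 < s" "s < 1" using \<open>1 < t\<close> by (auto simp: s_def)
    have "(1 - s) *\<^sub>R y + s *\<^sub>R ?x = y + (s * t) *\<^sub>R (z - y)" by (simp add: algebra_simps)
    then have "z = (1 - s) *\<^sub>R y + s *\<^sub>R ?x" using s(1) by simp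
    then have "z \<in> open_segment y ?x" unfolding in_segment using \<open>?x \<noteq> y\<close> s(2,3) by (intro conjI exI[of _ s]) auto
    then show False using in_interior_closure_convex_segment[OF P y xc(1)] zc(2) by blast
  qed
  ultimately show ?thesis by simp
qed

text \<open>As the point on the ray differs from \<open>z\<close>, its line through \<open>z\<close>
  also contains \<open>y\<close>. This turns a condition on the whole ray into one on
  \<open>y\<close> alone.\<close>

lemma ray_meets_affine_hull:
  assumes x: "y + t *\<^sub>R (z - y) \<in> affine hull S" and z: "z \<notin> affine hull S"
  shows "y \<in> affine hull (insert z S)"
proof -
  let ?x = "y + t *\<^sub>R (z - y)" and ?A = "affine hull (insert z S)"
  have "t \<noteq> 1" using x z by auto
  have "?x \<in> ?A" using x hull_mono[of S "insert z S" affine] by blast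
  moreover have "z \<in> ?A" by (simp add: hull_inc)
  moreover define s where "s = 1 / (1 - t)"
  ultimately have "s *\<^sub>R ?x + (1 - s) *\<^sub>R z \<in> ?A"
    by (intro mem_affine[OF affine_affine_hull]) auto
  also have "s *\<^sub>R ?x + (1 - s) *\<^sub>R z = (s * (1 - t)) *\<^sub>R y + (1 - s * (1 - t)) *\<^sub>R z"
    by (simp add: algebra_simps)
  also have "s * (1 - t) = 1" using \<open>t \<noteq> 1\<close> by (simp add: s_def)
  finally show ?thesis by simp
qed

section \<open>The parity argument for a labelled manifold\<close>

locale labelled_manifold = triangulated_manifold "DIM('b::euclidean_space)" M T
  for M :: "'a::euclidean_space set" and T +
  fixes P :: "'b::euclidean_space set" and p :: "nat \<Rightarrow> 'b" and n :: nat and L :: "'a \<Rightarrow> nat"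
  assumes P: "convex P" "closed P" "interior P \<noteq> {}"
    and p: "inj_on p {1..n}" "p ` {1..n} \<subseteq> P"
    and L: "L ` complex_vertices T \<subseteq> {1..n}"
    and boundary: "label_map T p L ` pl_boundary DIM('b) M \<subseteq> frontier P"
begin

abbreviation f :: "'a \<Rightarrow> 'b" where "f \<equiv> label_map T p L"

abbreviation q :: "'a \<Rightarrow> 'b" where "q v \<equiv> p (L v)"

lemma labels: "\<sigma> \<in> T \<Longrightarrow> L ` simplex_vertices \<sigma> \<subseteq> {1..n}"
  using L by (auto simp: complex_vertices_def)

lemma card_labels:
  assumes "finite W"
  shows "card (L ` W) \<le> card W"
  using assms by (rule card_image_le)

lemma generic_point_covered:
  assumes y: "y \<in> interior P" and z: "z \<in> frontier P"
    and gz: "\<And>I. I \<subseteq> {1..n} \<Longrightarrow> card I < DIM('b) \<Longrightarrow> z \<notin> affine hull (p ` I)"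
    and gyz: "\<And>I. I \<subseteq> {1..n} \<Longrightarrow> card I < DIM('b) \<Longrightarrow> y \<notin> affine hull (insert z (p ` I))"
    and gy: "\<And>I. I \<subseteq> {1..n} \<Longrightarrow> card I \<le> DIM('b) \<Longrightarrow> y \<notin> affine hull (p ` I)"
    and odd: "odd (card {\<tau> \<in> odd_facets. z \<in> f ` \<tau>})"
  shows "\<exists>\<sigma>\<in>T. y \<in> f ` \<sigma> \<and> aff_dim \<sigma> = int DIM('b)"
proof (rule ccontr)
  assume no: "\<not> ?thesis"
  let ?d = "DIM('b)"
  define u where "u = z - y"
  have u: "u \<noteq> 0" using y z by (auto simp: u_def frontier_def)
  define hit where "hit \<tau> \<longleftrightarrow> (\<exists>t\<ge>0. y + t *\<^sub>R u \<in> f ` \<tau>)" for \<tau>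
  define D where "D = {\<sigma> \<in> T. aff_dim \<sigma> = int ?d}"
  define H where "H = {\<tau> \<in> T. aff_dim \<tau> = int ?d - 1 \<and> hit \<tau>}"
  have fin: "finite T" using T(1) by (simp add: simplicial_complex_def)
  have qL: "q ` W = p ` (L ` W)" for W by auto
  have "even (card {\<tau> \<in> H. \<tau> \<subseteq> \<sigma>})" if s: "\<sigma> \<in> D" for \<sigma>
  proof -
    have sT: "\<sigma> \<in> T" "aff_dim \<sigma> = int ?d" using s by (auto simp: D_def)
    note v = simplicial_complex_vertices[OF T(1) sT(1)]
    let ?V = "simplex_vertices \<sigma>"
    have card: "card ?V = ?d + 1" using v(4) sT(2) by simp
    have even: "even (card {v \<in> ?V. \<exists>t\<ge>0. y + t *\<^sub>R u \<in> convex hull (q ` (?V - {v}))})"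
    proof (rule even_card_facets_hit[OF v(1) card u])
      fix v w and t :: real assume vw: "v \<in> ?V" "w \<in> ?V" "v \<noteq> w" "0 \<le> t"
      \<comment> \<open>A codimension-two face has \<open>d - 1\<close> vertices and possibly fewer
        labels; positivity of the dimension makes this number strictly less than \<open>d\<close>
        despite truncated subtraction.\<close>
      have "card (?V - {v, w}) = ?d - 1" using vw card v(1) by (simp add: card_Diff_subset)
      then have c: "card (L ` (?V - {v, w})) < ?d"
        using card_labels[OF finite_Diff[OF v(1), of "{v, w}"]] DIM_positive[where 'a = 'b] by linarith
      have sub: "L ` (?V - {v, w}) \<subseteq> {1..n}" using labels[OF sT(1)] by blast
      show "y + t *\<^sub>R u \<notin> convex hull (q ` (?V - {v, w}))"
      proof
        assume "y + t *\<^sub>R u \<in> convex hull (q ` (?V - {v, w}))"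
        then have "y + t *\<^sub>R (z - y) \<in> affine hull (p ` (L ` (?V - {v, w})))"
          using convex_hull_subset_affine_hull unfolding qL u_def by blast
        from ray_meets_affine_hull[OF this gz[OF sub c]] show False using gyz[OF sub c] by blast
      qed
    next
      fix v assume "v \<in> ?V"
      then have "card (?V - {v}) = ?d" using card v(1) by simp
      then have c: "card (L ` (?V - {v})) \<le> ?d" using card_labels[of "?V - {v}"] v(1) by simp
      have sub: "L ` (?V - {v}) \<subseteq> {1..n}" using labels[OF sT(1)] by blast
      show "y \<notin> convex hull (q ` (?V - {v}))"
        using gy[OF sub c] convex_hull_subset_affine_hull unfolding qL by blast
    next
      show "y \<notin> convex hull (q ` ?V)"
        using no sT label_map_image[OF T(1) sT(1), of p L] by auto
    qed
    have inj: "inj_on (\<lambda>v. convex hull (?V - {v})) ?V"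
    proof (rule inj_onI)
      fix v w assume vw: "v \<in> ?V" "w \<in> ?V" "convex hull (?V - {v}) = convex hull (?V - {w})"
      have "?V - {v} = simplex_vertices (convex hull (?V - {v}))"
        by (rule simplicial_complex_hull_subset(2)[OF T(1) sT(1) Diff_subset, symmetric])
      also have "\<dots> = ?V - {w}"
        unfolding vw(3) by (rule simplicial_complex_hull_subset(2)[OF T(1) sT(1) Diff_subset])
      finally show "v = w" using vw(1,2) by blast
    qed
    have facet: "convex hull (?V - {v}) \<in> T" "aff_dim (convex hull (?V - {v})) = int ?d - 1"
      "convex hull (?V - {v}) \<subseteq> \<sigma>" "f ` (convex hull (?V - {v})) = convex hull (q ` (?V - {v}))"
      if "v \<in> ?V" for v
    proof -
      note h = simplicial_complex_hull_subset[OF T(1) sT(1) Diff_subset[of ?V "{v}"]]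
      show "convex hull (?V - {v}) \<in> T" by (rule h(1))
      have "card (?V - {v}) = ?d" using card v(1) that by simp
      then show "aff_dim (convex hull (?V - {v})) = int ?d - 1"
        using simplicial_complex_vertices(4)[OF T(1) h(1)] h(2) by simp
      show "convex hull (?V - {v}) \<subseteq> \<sigma>" using hull_mono[of "?V - {v}" ?V convex] v(3) by auto
      show "f ` (convex hull (?V - {v})) = convex hull (q ` (?V - {v}))"
        using label_map_image[OF T(1) h(1), of p L] h(2) by simp
    qed
    \<comment> \<open>The facets of \<sigma> correspond to the omitted vertex, so the count over
      vertices becomes one over simplices of \<open>T\<close>.\<close>
    have "{\<tau> \<in> H. \<tau> \<subseteq> \<sigma>}
        = (\<lambda>v. convex hull (?V - {v})) ` {v \<in> ?V. \<exists>t\<ge>0. y + t *\<^sub>R u \<in> convex hull (q ` (?V - {v}))}"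
      (is "_ = ?g ` ?X")
    proof
      show "?g ` ?X \<subseteq> {\<tau> \<in> H. \<tau> \<subseteq> \<sigma>}"
        using facet by (auto simp: H_def hit_def)
      show "{\<tau> \<in> H. \<tau> \<subseteq> \<sigma>} \<subseteq> ?g ` ?X"
      proof
        fix \<tau> assume "\<tau> \<in> {\<tau> \<in> H. \<tau> \<subseteq> \<sigma>}"
        then have t: "\<tau> \<in> T" "aff_dim \<tau> = int ?d - 1" "hit \<tau>" "\<tau> \<subseteq> \<sigma>" by (auto simp: H_def)
        then have "\<sigma> \<in> cofaces T \<tau>" using sT by (simp add: cofaces_def)
        then obtain a where a: "a \<notin> simplex_vertices \<tau>" "?V = insert a (simplex_vertices \<tau>)"
          using coface_apex[OF T(1) t(1)] by blast
        then have "?V - {a} = simplex_vertices \<tau>" by blast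
        then have "\<tau> = ?g a" using simplicial_complex_vertices(3)[OF T(1) t(1)] by simp
        have aV: "a \<in> ?V" using a(2) by blast
        have "f ` \<tau> = convex hull (q ` (?V - {a}))"
          by (subst \<open>\<tau> = ?g a\<close>) (rule facet(4)[OF aV])
        then have "a \<in> ?X" using t(3) aV unfolding hit_def by simp
        with \<open>\<tau> = ?g a\<close> show "\<tau> \<in> ?g ` ?X" by blast
      qed
    qed
    moreover have "inj_on ?g ?X" using inj by (rule inj_on_subset) blast
    ultimately show ?thesis using even by (simp only: card_image)
  qed
  then have "even (\<Sum>\<sigma>\<in>D. card {\<tau> \<in> H. \<tau> \<subseteq> \<sigma>})" by (rule dvd_sum)
  \<comment> \<open>Double counting of the pairs of a \<open>d\<close>-simplex and a hit facet of
    it.\<close>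
  also have "(\<Sum>\<sigma>\<in>D. card {\<tau> \<in> H. \<tau> \<subseteq> \<sigma>}) = (\<Sum>\<tau>\<in>H. card (cofaces T \<tau>))"
  proof (rule sum_multicount_gen)
    show "\<forall>\<tau>\<in>H. card {\<sigma> \<in> D. \<tau> \<subseteq> \<sigma>} = card (cofaces T \<tau>)"
      by (auto simp: H_def D_def cofaces_def intro!: arg_cong[of _ _ card])
  qed (use fin in \<open>auto simp: D_def H_def\<close>)
  also have "even \<dots> \<longleftrightarrow> even (card {\<tau> \<in> H. odd (card (cofaces T \<tau>))})"
    by (rule even_sum_iff) (use fin in \<open>simp add: H_def\<close>)
  also have "{\<tau> \<in> H. odd (card (cofaces T \<tau>))} = {\<tau> \<in> odd_facets. z \<in> f ` \<tau>}"
  proof -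
    have "hit \<tau> \<longleftrightarrow> z \<in> f ` \<tau>" if "\<tau> \<in> odd_facets" for \<tau>
    proof
      assume "hit \<tau>"
      then obtain t where t: "0 \<le> t" "y + t *\<^sub>R u \<in> f ` \<tau>" by (auto simp: hit_def)
      then have "y + t *\<^sub>R u \<in> frontier P" using odd_facets_subset_boundary[OF that] boundary by blast
      then have "t = 1" using ray_frontier_unique[OF P(1) y z t(1)] by (simp add: u_def)
      then show "z \<in> f ` \<tau>" using t(2) by (simp add: u_def)
    next
      assume "z \<in> f ` \<tau>"
      then show "hit \<tau>" by (auto simp: hit_def u_def intro!: exI[of _ 1])
    qed
    then show ?thesis by (auto simp: H_def odd_facets_def)
  qed
  finally show False using odd by blast
qed

text \<open>The proper faces of a boundary facet are boundary simplices of dimension below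
  \<open>d - 1\<close>, so a generic \<open>z\<close> misses their images, and minimality makes the
  vertex images affinely independent.\<close>

lemma generic_facet:
  assumes g: "generic_boundary_value P p T L z" and \<tau>: "\<tau> \<in> odd_facets" "z \<in> f ` \<tau>"
  shows "inj_on q (simplex_vertices \<tau>)" "\<not> affine_dependent (q ` simplex_vertices \<tau>)"
    "z \<in> rel_interior (f ` \<tau>)" "aff_dim (f ` \<tau>) = int DIM('b) - 1"
    "\<And>x x'. x \<in> \<tau> \<Longrightarrow> x' \<in> \<tau> \<Longrightarrow> f x = f x' \<Longrightarrow> x = x'"
proof -
  have t: "\<tau> \<in> T" "aff_dim \<tau> = int DIM('b) - 1" using \<tau>(1) by (auto simp: odd_facets_def)
  let ?V = "simplex_vertices \<tau>"
  note v = simplicial_complex_vertices[OF T(1) t(1)]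
  have im: "f ` \<tau> = convex hull (q ` ?V)" by (rule label_map_image[OF T(1) t(1)])
  have "z \<notin> convex hull (q ` (?V - {v}))" if "v \<in> ?V" for v
  proof -
    note h = simplicial_complex_hull_subset[OF T(1) t(1) Diff_subset[of ?V "{v}"]]
    have "convex hull (?V - {v}) \<subseteq> \<tau>" using hull_mono[of "?V - {v}" ?V convex] v(3) by auto
    then have b: "convex hull (?V - {v}) \<subseteq> pl_boundary DIM('b) (\<Union>T)"
      using odd_facets_subset_boundary[OF \<tau>(1)] T(2) by blast
    have "card (?V - {v}) < card ?V" using v(1) that by (rule card_Diff1_less)
    then have "aff_dim (convex hull (?V - {v})) < int DIM('b) - 1"
      using simplicial_complex_vertices(4)[OF T(1) h(1)] h(2) v(4) t(2) by simp
    then have "z \<notin> f ` (convex hull (?V - {v}))"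
      using g b h(1) by (simp add: generic_boundary_value_def)
    then show ?thesis using label_map_image[OF T(1) h(1), of p L] h(2) by simp
  qed
  note m = minimal_convex_hull[OF v(1) \<tau>(2)[unfolded im] this]
  show inj: "inj_on q ?V" and ind: "\<not> affine_dependent (q ` ?V)" and "z \<in> rel_interior (f ` \<tau>)"
    using m im by simp_all
  show "aff_dim (f ` \<tau>) = int DIM('b) - 1"
    using aff_dim_affine_independent[OF ind] card_image[OF inj] v(4) t(2) im
    by (simp add: aff_dim_convex_hull)
  \<comment> \<open>The inverse of \<open>q\<close> on the vertices extends to an affine left
    inverse of \<open>f\<close> on \<tau>.\<close>
  from affine_extension[OF ind, of "inv_into ?V q"]
  obtain h c where h: "linear h" "\<forall>s\<in>q ` ?V. h s + c = inv_into ?V q s" by (elim exE conjE)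
  have iv: "inv_into ?V q (q v) = v" if "v \<in> ?V" for v
    by (rule inv_into_f_f[OF inj that])
  have inv: "h (f x) + c = x" if "x \<in> \<tau>" for x
  proof -
    have "x \<in> convex hull ?V" using that v(3) by simp
    then obtain u where u: "\<forall>v\<in>?V. 0 \<le> u v" "sum u ?V = 1" "(\<Sum>v\<in>?V. u v *\<^sub>R v) = x"
      unfolding convex_hull_finite[OF v(1)] mem_Collect_eq by (elim exE conjE)
    have "f x = (\<Sum>v\<in>?V. u v *\<^sub>R q v)"
      using label_map_sum[OF T(1) t(1) u(1,2), of p L] unfolding u(3) .
    then have "h (f x) + c = (\<Sum>v\<in>?V. u v *\<^sub>R h (q v)) + sum u ?V *\<^sub>R c"
      using u(2) h(1) by (simp add: linear_sum linear_scale)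
    also have "\<dots> = (\<Sum>v\<in>?V. u v *\<^sub>R (h (q v) + c))"
      by (simp add: scaleR_right_distrib sum.distrib scaleR_sum_left)
    also have "\<dots> = (\<Sum>v\<in>?V. u v *\<^sub>R v)"
      using h(2) iv by (intro sum.cong) simp_all
    finally show ?thesis using u(3) by simp
  qed
  show "x = x'" if "x \<in> \<tau>" "x' \<in> \<tau>" "f x = f x'" for x x'
    using inv[OF that(1)] inv[OF that(2)] that(3) by metis
qed

text \<open>Translates the topological count in \<open>deg2\<close> into a combinatorial one: the
  odd facets cover the boundary, each contains at most one preimage, and a preimage in two of them
  would lie in a boundary simplex of dimension below \<open>d - 1\<close>.\<close>

lemma card_preimages_eq_card_facets:
  assumes g: "generic_boundary_value P p T L z"
  shows "card {x \<in> pl_boundary DIM('b) M. f x = z} = card {\<tau> \<in> odd_facets. z \<in> f ` \<tau>}"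
proof -
  let ?X = "{x \<in> pl_boundary DIM('b) M. f x = z}" and ?Y = "{\<tau> \<in> odd_facets. z \<in> f ` \<tau>}"
  have "\<exists>x. x \<in> \<tau> \<and> f x = z" if "\<tau> \<in> ?Y" for \<tau> using that by auto
  then have "\<forall>\<tau>\<in>?Y. \<exists>x. x \<in> \<tau> \<and> f x = z" by blast
  from bchoice[OF this] obtain g where g': "\<forall>\<tau>\<in>?Y. g \<tau> \<in> \<tau> \<and> f (g \<tau>) = z" by blast
  have "inj_on g ?Y"
  proof (rule inj_onI, rule ccontr)
    fix \<tau> \<tau>' assume t: "\<tau> \<in> ?Y" "\<tau>' \<in> ?Y" "g \<tau> = g \<tau>'" "\<tau> \<noteq> \<tau>'"
    have tT: "\<tau> \<in> T" "\<tau>' \<in> T" "aff_dim \<tau> = int DIM('b) - 1" "aff_dim \<tau>' = int DIM('b) - 1"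
      using t(1,2) by (auto simp: odd_facets_def)
    note I = simplicial_complex_Int[OF T(1) tT(1,2)]
    obtain m m' where m: "m simplex \<tau>" "m' simplex \<tau>'"
      using simplicial_complex_simplex[OF T(1)] tT(1,2) by metis
    have "aff_dim (\<tau> \<inter> \<tau>') < int DIM('b) - 1"
    proof (cases "\<tau> \<inter> \<tau>' = \<tau>")
      case True
      then have "\<tau> \<inter> \<tau>' \<noteq> \<tau>'" using t(4) by blast
      then show ?thesis using face_of_aff_dim_lt[OF convex_simplex[OF m(2)] I(3)] tT(4) by simp
    next
      case False
      then show ?thesis using face_of_aff_dim_lt[OF convex_simplex[OF m(1)] I(2)] tT(3) by simp
    qed
    moreover have "\<tau> \<inter> \<tau>' \<subseteq> pl_boundary DIM('b) (\<Union>T)"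
      using odd_facets_subset_boundary[of \<tau>] t(1) T(2) by blast
    ultimately have "z \<notin> f ` (\<tau> \<inter> \<tau>')" using g I(1) by (simp add: generic_boundary_value_def)
    moreover have "g \<tau> \<in> \<tau>" "g \<tau> \<in> \<tau>'" "f (g \<tau>) = z" using bspec[OF g' t(1)] bspec[OF g' t(2)] t(3) by auto
    ultimately show False by blast
  qed
  moreover have "g ` ?Y = ?X"
  proof
    show "g ` ?Y \<subseteq> ?X"
      using g' odd_facets_subset_boundary by blast
    show "?X \<subseteq> g ` ?Y"
    proof
      fix x assume x: "x \<in> ?X"
      then obtain \<tau> where t: "\<tau> \<in> odd_facets" "x \<in> \<tau>" using boundary_subset_odd_facets by blast
      then have tY: "\<tau> \<in> ?Y" using x by auto
      have "g \<tau> = x"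
        using generic_facet(5)[OF g t(1), of "g \<tau>" x] bspec[OF g' tY] tY t(2) x by simp
      then show "x \<in> g ` ?Y" using tY by blast
    qed
  qed
  ultimately have "bij_betw g ?Y ?X" by (simp add: bij_betw_def)
  then show ?thesis using bij_betw_same_card by fastforce
qed

text \<open>
  A generic boundary value may still lie in the image of an interior simplex of dimension at most
  \<open>d - 2\<close>, so it has to be moved within its supporting hyperplane.
\<close>

lemma perturb_boundary_value:
  assumes g: "generic_boundary_value P p T L z0" and odd: "odd (card {\<tau> \<in> odd_facets. z0 \<in> f ` \<tau>})"
  obtains z where "z \<in> frontier P" "odd (card {\<tau> \<in> odd_facets. z \<in> f ` \<tau>})"
    "\<forall>I. I \<subseteq> {1..n} \<longrightarrow> card I < DIM('b) \<longrightarrow> z \<notin> affine hull (p ` I)"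
proof -
  let ?B = "{\<tau> \<in> odd_facets. z0 \<in> f ` \<tau>}"
  have fin: "finite odd_facets" using T(1) by (simp add: simplicial_complex_def odd_facets_def)
  have tT: "\<tau> \<in> T" if "\<tau> \<in> odd_facets" for \<tau> using that by (simp add: odd_facets_def)
  have im: "f ` \<tau> = convex hull (q ` simplex_vertices \<tau>)" if "\<tau> \<in> odd_facets" for \<tau>
    using label_map_image[OF T(1) tT[OF that]] .
  have z0: "z0 \<in> frontier P" using g by (simp add: generic_boundary_value_def)
  have ri: "rel_interior P = interior P" using rel_interior_nonempty_interior[OF P(3)] .
  have "z0 \<in> closure P" "z0 \<notin> rel_interior P" using z0 ri by (auto simp: frontier_def)
  then obtain a where a: "a \<noteq> 0" "\<forall>x\<in>closure P. a \<bullet> z0 \<le> a \<bullet> x"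
    by (rule supporting_hyperplane_relative_frontier[OF P(1)]) (use that in blast)
  define H where "H = {x. a \<bullet> x = a \<bullet> z0}"
  have face: "(P \<inter> H) face_of P"
    unfolding H_def by (rule face_of_Int_supporting_hyperplane_ge[OF P(1)]) (use a(2) closure_subset in blast)
  have fP: "f ` \<tau> \<subseteq> P" if "\<tau> \<in> odd_facets" for \<tau>
  proof -
    have "q ` simplex_vertices \<tau> \<subseteq> P" using labels[OF tT[OF that]] p(2) by blast
    then show ?thesis using im[OF that] P(1) by (simp add: hull_minimal)
  qed
  have zP: "z0 \<in> P" using z0 P(2) by (simp add: frontier_def)
  have "\<exists>V. open V \<and> z0 \<in> V \<and> V \<inter> H \<subseteq> f ` \<tau>" if t: "\<tau> \<in> ?B" for \<tau>
  proof -
    have to: "\<tau> \<in> odd_facets" "z0 \<in> f ` \<tau>" using t by auto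
    note gf = generic_facet[OF g to]
    \<comment> \<open>\<open>z0\<close> is a relative interior point of the image, so the face cut
      out by \<open>H\<close> contains the whole image. Having dimension \<open>d - 1\<close>, the
      image is then a neighbourhood of \<open>z0\<close> within \<open>H\<close>.\<close>
    have "f ` \<tau> \<subseteq> P \<inter> H"
      by (rule subset_of_face_of[OF face fP[OF to(1)]]) (use gf(3) zP in \<open>auto simp: H_def\<close>)
    then have sub: "f ` \<tau> \<subseteq> H" by blast
    have "aff_dim H = int DIM('b) - 1" unfolding H_def using a(1) by simp
    then have "affine hull (f ` \<tau>) = affine hull H"
      using aff_dim_eq_full_gen[OF sub] gf(4) by simp
    also have "affine hull H = H" unfolding H_def by (simp add: affine_hyperplane)
    finally have "affine hull (f ` \<tau>) = H" .
    then show ?thesis using gf(3) by (auto simp: rel_interior)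
  qed
  then have "\<forall>\<tau>\<in>?B. \<exists>V. open V \<and> z0 \<in> V \<and> V \<inter> H \<subseteq> f ` \<tau>" by blast
  from bchoice[OF this] obtain V where V: "\<forall>\<tau>\<in>?B. open (V \<tau>) \<and> z0 \<in> V \<tau> \<and> V \<tau> \<inter> H \<subseteq> f ` \<tau>" ..
  \<comment> \<open>Within \<open>H\<close> and this open set the facets whose images contain the
    point do not change: the images through \<open>z0\<close> are neighbourhoods in
    \<open>H\<close>, and the other images are closed.\<close>
  define O' where "O' = (\<Inter>\<tau>\<in>?B. V \<tau>) \<inter> (\<Inter>\<tau>\<in>odd_facets - ?B. - f ` \<tau>)"
  have "closed (f ` \<tau>)" if "\<tau> \<in> odd_facets" for \<tau>
    using im[OF that] simplicial_complex_vertices(1)[OF T(1) tT[OF that]]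
    by (simp add: finite_imp_compact_convex_hull compact_imp_closed)
  then have "open O'" unfolding O'_def using fin V by (intro open_Int open_INT) auto
  moreover have "z0 \<in> O'" using V by (auto simp: O'_def)
  ultimately obtain e where e: "0 < e" "ball z0 e \<subseteq> O'" using openE by blast
  let ?C = "H \<inter> ball z0 e"
  have convH: "convex H" unfolding H_def by (rule convex_hyperplane)
  have ne: "?C \<noteq> {}" using e(1) by (auto simp: H_def)
  have dimC: "aff_dim ?C = int DIM('b) - 1"
    using aff_dim_convex_Int_open[OF convH _ ne] a(1) by (simp add: H_def)
  define \<A> where "\<A> = (\<lambda>I. p ` I) ` {I. I \<subseteq> {1..n} \<and> card I < DIM('b)}"
  obtain z where z: "z \<in> ?C" "\<And>A. A \<in> \<A> \<Longrightarrow> z \<notin> affine hull A"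
  proof (rule convex_not_covered_aff_dim[of \<A> ?C])
    show "finite \<A>" by (simp add: \<A>_def)
    show "convex ?C" using convH by (simp add: convex_Int)
    show "?C \<noteq> {}" by (rule ne)
    fix A assume "A \<in> \<A>"
    then obtain I where I: "I \<subseteq> {1..n}" "card I < DIM('b)" "A = p ` I" by (auto simp: \<A>_def)
    have fI: "finite I" using I(1) finite_subset by blast
    have "aff_dim A \<le> int (card A) - 1" using aff_dim_le_card[of A] I(3) fI by simp
    moreover have "card A \<le> card I" using I(3) fI card_image_le by simp
    ultimately show "aff_dim A < aff_dim ?C" using I(2) dimC by simp
  qed (use that in blast)
  have "z \<in> f ` \<tau> \<longleftrightarrow> z0 \<in> f ` \<tau>" if "\<tau> \<in> odd_facets" for \<tau>
  proof (cases "\<tau> \<in> ?B")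
    case True
    then have "z \<in> V \<tau> \<inter> H" using z(1) e(2) by (auto simp: O'_def)
    then show ?thesis using V True by blast
  next
    case False
    then have "z \<in> - f ` \<tau>" using that z(1) e(2) unfolding O'_def by blast
    then show ?thesis using False that by blast
  qed
  then have eq: "{\<tau> \<in> odd_facets. z \<in> f ` \<tau>} = ?B" by blast
  \<comment> \<open>That \<open>z\<close> lies in \<open>H\<close> does not put it on the frontier
    of \<open>P\<close>; lying in the image of a boundary facet does, and the odd count supplies
    one.\<close>
  have "?B \<noteq> {}" using odd by (metis card.empty even_zero)
  then obtain \<tau> where "\<tau> \<in> odd_facets" "z \<in> f ` \<tau>" using eq by blast
  then have "z \<in> frontier P" using odd_facets_subset_boundary boundary by blast
  moreover have "z \<notin> affine hull (p ` I)" if "I \<subseteq> {1..n}" "card I < DIM('b)" for I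
    using z(2)[of "p ` I"] that by (auto simp: \<A>_def)
  ultimately show ?thesis using that[of z] eq odd by auto
qed

text \<open>With too few labels, or with a label in the flat of the others, \<open>y\<close> would
  lie in a flat spanned by at most \<open>d\<close> vertices of \<open>P\<close>.\<close>

lemma affine_independent_labels:
  assumes I: "I \<subseteq> {1..n}" "card I \<le> DIM('b) + 1" and y: "y \<in> convex hull (p ` I)"
    and gy: "\<And>J. J \<subseteq> {1..n} \<Longrightarrow> card J \<le> DIM('b) \<Longrightarrow> y \<notin> affine hull (p ` J)"
  shows "card I = DIM('b) + 1" "int DIM('b) simplex (convex hull (p ` I))"
proof -
  have yI: "y \<in> affine hull (p ` I)" using y convex_hull_subset_affine_hull by blast
  show c: "card I = DIM('b) + 1" using I gy[OF I(1)] yI by (cases "card I \<le> DIM('b)") auto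
  have fI: "finite I" using I(1) finite_subset by blast
  have injI: "inj_on p I" using p(1) I(1) inj_on_subset by blast
  have "\<not> affine_dependent (p ` I)"
  proof
    assume "affine_dependent (p ` I)"
    then obtain i where i: "i \<in> I" "p i \<in> affine hull (p ` I - {p i})" by (auto simp: affine_dependent_def)
    have eq: "p ` I - {p i} = p ` (I - {i})" using injI i(1) by (auto simp: inj_on_def)
    have "insert (p i) (p ` (I - {i})) = p ` I" using i(1) by blast
    then have "affine hull (p ` I) = affine hull (p ` (I - {i}))"
      using hull_redundant[OF i(2)[unfolded eq]] by simp
    moreover have "card (I - {i}) \<le> DIM('b)" using c i(1) fI by simp
    ultimately show False using gy[of "I - {i}"] yI I(1) by blast
  qed
  then show "int DIM('b) simplex (convex hull (p ` I))"
    using c card_image[OF injI] by (intro simplex_convex_hull) simp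
qed

text \<open>Passage from generic points to all of \<open>P\<close>: the nondegenerate image
  simplices are finitely many compact sets chosen independently of the point, so their union is
  closed and cannot miss \<open>y\<close> while it contains generic points arbitrarily close to
  it.\<close>

lemma covered_if_odd_degree:
  assumes g: "generic_boundary_value P p T L z0"
    and odd: "odd (card {x \<in> pl_boundary DIM('b) M. f x = z0})" and y: "y \<in> P"
  shows "\<exists>\<sigma>\<in>T. L ` simplex_vertices \<sigma> \<in> cov p n y"
proof -
  obtain z where z: "z \<in> frontier P" "odd (card {\<tau> \<in> odd_facets. z \<in> f ` \<tau>})"
    "\<forall>I. I \<subseteq> {1..n} \<longrightarrow> card I < DIM('b) \<longrightarrow> z \<notin> affine hull (p ` I)"
    using perturb_boundary_value[OF g] odd card_preimages_eq_card_facets[OF g] by auto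
  have fin: "finite T" using T(1) by (simp add: simplicial_complex_def)
  define full where "full = {I. I \<subseteq> {1..n} \<and> card I = DIM('b) + 1 \<and> int DIM('b) simplex (convex hull (p ` I))}"
  define Y where "Y = (\<Union>\<sigma>\<in>{\<sigma> \<in> T. L ` simplex_vertices \<sigma> \<in> full}. convex hull (p ` (L ` simplex_vertices \<sigma>)))"
  have "closed Y"
    unfolding Y_def using fin simplicial_complex_vertices(1)[OF T(1)]
    by (intro closed_UN) (auto simp: finite_imp_compact_convex_hull compact_imp_closed)
  have "y \<in> Y"
  proof (rule ccontr)
    assume "y \<notin> Y"
    then obtain e where e: "0 < e" "ball y e \<subseteq> - Y"
      using openE[of "- Y" y] \<open>closed Y\<close> by auto
    let ?C = "interior P \<inter> ball y e"
    have "y \<in> closure (interior P)"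
      using convex_closure_interior[OF P(1,3)] y closure_subset by blast
    then have "ball y e \<inter> closure (interior P) \<noteq> {}" using centre_in_ball e(1) by blast
    then have ne: "?C \<noteq> {}" by (simp add: open_Int_closure_eq_empty Int_commute)
    have dimC: "aff_dim ?C = int DIM('b)" by (rule aff_dim_open[OF _ ne]) auto
    \<comment> \<open>Each of these sets has affine dimension at most \<open>d - 1\<close>: a join
      of \<open>z\<close> with fewer than \<open>d\<close> points, or at most \<open>d\<close>
      points alone. Avoiding them supplies the conditions on \<open>y\<close> in
      \<open>generic_point_covered\<close>.\<close>
    define \<A> where "\<A> = (\<lambda>I. insert z (p ` I)) ` {I. I \<subseteq> {1..n} \<and> card I < DIM('b)}
        \<union> (\<lambda>I. p ` I) ` {I. I \<subseteq> {1..n} \<and> card I \<le> DIM('b)}"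
    have dimp: "aff_dim (p ` I) \<le> int (card I) - 1" if "I \<subseteq> {1..n}" for I
    proof -
      have fI: "finite I" using that finite_subset by blast
      then show ?thesis using aff_dim_le_card[of "p ` I"] card_image_le[OF fI, of p] by simp
    qed
    obtain x where x: "x \<in> ?C" "\<And>A. A \<in> \<A> \<Longrightarrow> x \<notin> affine hull A"
    proof (rule convex_not_covered_aff_dim[of \<A> ?C])
      show "finite \<A>" by (simp add: \<A>_def)
      show "convex ?C" using P(1) by (simp add: convex_Int convex_interior)
      show "?C \<noteq> {}" by (rule ne)
      fix A assume "A \<in> \<A>"
      then consider I where "I \<subseteq> {1..n}" "card I < DIM('b)" "A = insert z (p ` I)"
        | I where "I \<subseteq> {1..n}" "card I \<le> DIM('b)" "A = p ` I" by (auto simp: \<A>_def)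
      then show "aff_dim A < aff_dim ?C"
      proof cases
        case 1
        then show ?thesis using dimp[OF 1(1)] dimC by (simp add: aff_dim_insert)
      next
        case 2
        then show ?thesis using dimp[OF 2(1)] dimC by simp
      qed
    qed (use that in blast)
    have gxz: "x \<notin> affine hull (insert z (p ` I))" if "I \<subseteq> {1..n}" "card I < DIM('b)" for I
      by (rule x(2)) (use that in \<open>auto simp: \<A>_def\<close>)
    have gx: "x \<notin> affine hull (p ` I)" if "I \<subseteq> {1..n}" "card I \<le> DIM('b)" for I
      by (rule x(2)) (use that in \<open>auto simp: \<A>_def\<close>)
    obtain \<sigma> where s: "\<sigma> \<in> T" "x \<in> f ` \<sigma>" "aff_dim \<sigma> = int DIM('b)"
      using generic_point_covered[OF _ z(1) _ gxz gx z(2)] x(1) z(3) by blast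
    note v = simplicial_complex_vertices[OF T(1) s(1)]
    let ?I = "L ` simplex_vertices \<sigma>"
    have xI: "x \<in> convex hull (p ` ?I)"
      using s(2) label_map_image[OF T(1) s(1), of p L] by (simp add: image_image)
    have "card ?I \<le> DIM('b) + 1" using card_labels[OF v(1)] v(4) s(3) by simp
    from affine_independent_labels[OF labels[OF s(1)] this xI gx]
    have "?I \<in> full" using labels[OF s(1)] by (simp add: full_def)
    then have "x \<in> Y" using s(1) xI by (auto simp: Y_def)
    then show False using x(1) e(2) by blast
  qed
  then show ?thesis by (auto simp: Y_def full_def cov_def)
qed

end

theorem theorem4p2:
  fixes P :: "'b::euclidean_space set"
    and p :: "nat \<Rightarrow> 'b"
    and n :: nat
    and M :: "'a::euclidean_space set"
    and T :: "'a set set"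
    and L :: "'a \<Rightarrow> nat"
    and y :: 'b
  assumes "polytope P"
    and "aff_dim P = int DIM('b)"
    and "bij_betw p {1..n} {v. v extreme_point_of P}"
    and "compact M"
    and "pl_manifold DIM('b) M"
    and "simplicial_complex T"
    and "\<Union>T = M"
    and "L ` complex_vertices T \<subseteq> {1..n}"
    and "label_map T p L ` pl_boundary DIM('b) M \<subseteq> frontier P"
    and "deg2 P p T L \<noteq> 0"
    and "y \<in> P"
  shows "\<exists>\<sigma>\<in>T. L ` simplex_vertices \<sigma> \<in> cov p n y"
proof -
  have cP: "convex P" by (rule polytope_imp_convex[OF assms(1)])
  interpret labelled_manifold M T P p n L
  proof
    \<comment> \<open>Full dimension identifies interior and relative interior, and \<open>P\<close>
      is nonempty because it contains \<open>y\<close>.\<close>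
    show "interior P \<noteq> {}" using assms(2,11) cP by (auto simp: interior_rel_interior_gen rel_interior_eq_empty)
    show "p ` {1..n} \<subseteq> P" using assms(3) by (auto simp: bij_betw_def extreme_point_of_def)
    show "inj_on p {1..n}" using assms(3) by (simp add: bij_betw_def)
  qed (use assms cP polytope_imp_closed in auto)
  obtain z0 where "generic_boundary_value P p T L z0"
    "odd (card {x \<in> pl_boundary DIM('b) (\<Union>T). label_map T p L x = z0})"
    using assms(10) by (auto simp: deg2_def split: if_splits)
  then show ?thesis using covered_if_odd_degree assms(7,11) by blast
qed

end
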